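(* Let $1<p<\infty$ and let $f\in L^p$ be a first-order Haar chaos such that both $\hat f$ and $1/\hat f$ belong to $M_p^+(\mathbb D_{2^{-1/p}})$. Let $\{d_k\}_{k\ge0}$ be the Taylor coefficients of $1/\hat f$ and, for $n\ge1$, let $m=\lfloor\log_2 n\rfloor$, let $\nu(n)$ be the largest integer with $2^{\nu(n)}\mid n$, and set $g^n=\sum_{j=0}^{\nu(n)}d_j2^{m-j}h_{n/2^j}$. Then the system of dilations and translations of $f$ is a basis in chaoses in $L^p$: for every mean-zero $x\in L^p$ and every $d\ge1$ the series $\sum_{n\in N_d}(x,g^n)f_n$ converges in $L^p$ to some $x_d$, and $x=\sum_{d=1}^\infty x_d$ with convergence in $L^p$.
   Context: All functions are complex-valued on $I=(0,1]$; $(u,v)=\int_0^1u(t)v(t)\,dt$. Let $h=\chi_{(0,1/2]}-\chi_{(1/2,1]}$. For $n=2^k+j$ with $k\ge0$, $0\le j\le 2^k-1$, $h_n(t)=h(2^kt-j)$ for $t\in(j2^{-k},(j+1)2^{-k}]$ and $0$ otherwise. For mean-zero $f\in L^1$, the system of dilations and translations is $f_n(t)=f(2^kt-j)$ on $(j2^{-k},(j+1)2^{-k}]$, $0$ otherwise. A first-order Haar chaos is a function $f=\sum_{k\ge0}c_kh_{2^k}$, $c_k\in\mathbb C$; its symbol is $\hat f(z)=\sum_kc_kz^k$. $N_d$ is the set of positive integers with exactly $d$ ones in their binary expansion. For $1\le p\le\infty$, $R>0$, $A_p^+(\mathbb D_R)$ is the Banach space of analytic $u(z)=\sum_ka_kz^k$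 in $\mathbb D_R=\{|z|<R\}$ with $\|u\|=\|(a_kR^k)_k\|_{\ell^p}<\infty$; $M_p^+(\mathbb D_R)$ is the Banach algebra of $u\in A_p^+(\mathbb D_R)$ with $uv\in A_p^+(\mathbb D_R)$ for every $v\in A_p^+(\mathbb D_R)$. *)

theory Defs
  imports "HOL-Analysis.Analysis" "HOL-Computational_Algebra.Primes"
begin

abbreviation I01 :: "real measure" where
  "I01 \<equiv> lebesgue_on {0<..1}"

definition Lp :: "real \<Rightarrow> (real \<Rightarrow> complex) \<Rightarrow> bool" where
  "Lp p u \<longleftrightarrow> u \<in> borel_measurable I01 \<and> integrable I01 (\<lambda>t. norm (u t) powr p)"

definition Lp_conv :: "real \<Rightarrow> (nat \<Rightarrow> real \<Rightarrow> complex) \<Rightarrow> (real \<Rightarrow> complex) \<Rightarrow> bool" where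
  "Lp_conv p s u \<longleftrightarrow> ((\<lambda>N. integral\<^sup>L I01 (\<lambda>t. norm (s N t - u t) powr p)) \<longlonglongrightarrow> 0)"

definition pair :: "(real \<Rightarrow> complex) \<Rightarrow> (real \<Rightarrow> complex) \<Rightarrow> complex" where
  "pair u v = integral\<^sup>L I01 (\<lambda>t. u t * v t)"

definition haar :: "real \<Rightarrow> complex" where
  "haar t = (if 0 < t \<and> t \<le> 1/2 then 1 else if 1/2 < t \<and> t \<le> 1 then -1 else 0)"

definition lev :: "nat \<Rightarrow> nat" where
  "lev n = nat \<lfloor>log 2 (real n)\<rfloor>"

definition pos :: "nat \<Rightarrow> nat" where
  "pos n = n - 2 ^ lev n"

definition dil :: "(real \<Rightarrow> complex) \<Rightarrow> nat \<Rightarrow> real \<Rightarrow> complex" where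
  "dil u n t = (if real (pos n) / 2 ^ lev n < t \<and> t \<le> (real (pos n) + 1) / 2 ^ lev n
                then u (2 ^ lev n * t - real (pos n)) else 0)"

abbreviation haar_n :: "nat \<Rightarrow> real \<Rightarrow> complex" where
  "haar_n n \<equiv> dil haar n"

text \<open>First-order Haar chaos with coefficients c (pointwise the sum is finite for t > 0).\<close>
definition haar_chaos :: "(nat \<Rightarrow> complex) \<Rightarrow> real \<Rightarrow> complex" where
  "haar_chaos c t = (\<Sum>k. c k * haar_n (2 ^ k) t)"

definition symbol :: "(nat \<Rightarrow> complex) \<Rightarrow> complex \<Rightarrow> complex" where
  "symbol c z = (\<Sum>k. c k * z ^ k)"

definition N_set :: "nat \<Rightarrow> nat set" where
  "N_set d = {n. 0 < n \<and> card {i. bit n i} = d}"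

definition taylor :: "(complex \<Rightarrow> complex) \<Rightarrow> nat \<Rightarrow> complex" where
  "taylor u k = (deriv ^^ k) u 0 / fact k"

definition Ap :: "real \<Rightarrow> real \<Rightarrow> (complex \<Rightarrow> complex) set" where
  "Ap p R = {u. u holomorphic_on ball 0 R \<and>
                summable (\<lambda>k. norm (taylor u k * complex_of_real R ^ k) powr p)}"

definition Mp :: "real \<Rightarrow> real \<Rightarrow> (complex \<Rightarrow> complex) set" where
  "Mp p R = {u \<in> Ap p R. \<forall>v \<in> Ap p R. (\<lambda>z. u z * v z) \<in> Ap p R}"

definition gfun :: "(nat \<Rightarrow> complex) \<Rightarrow> nat \<Rightarrow> real \<Rightarrow> complex" where
  "gfun d n t = (\<Sum>j = 0..multiplicity (2::nat) n.
                   d j * 2 ^ (lev n - j) * haar_n (n div 2 ^ j) t)"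

end

(*
  Write c for the coefficients of f, d for those of 1 / symbol c, and X_n = 2 ^ m (x, h_n). Multiplying
  n by 2 does not change its number of binary ones, so N_set d splits into chains q, 2 q, 4 q, ... with
  q odd; on each chain the coefficient (x, g^n) is the convolution of d with X, and expanding the f_n in
  Haar functions convolves with c. Hence the partial sums over N_set d differ from
  x_d = sum_{n in N_set d} X_n h_n by a Haar sum whose coefficients are c convolved with a tail of d * X.
  Three estimates make this difference tend to 0:

  - c and d act boundedly on the l^p sequences weighted by the lengths 2 ^ -m, since an element of
    M_p is automatically a bounded multiplier (gliding hump);
  - the Haar sum over N_set d is bounded in L^p by the weighted l^p norm of its coefficients, because
    at a point it equals a partial sum along a single chain, and the lengths halve along the chain
    (a discrete Hardy inequality);
  - dually, the weighted l^p norm of (X_n), n in N_set d, is bounded by the L^p norm of x, which is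
    where p > 1 enters.

  The sum x_1 + ... + x_D telescopes to the average of x over the dyadic interval at which the path
  of t has made D right turns. These averages contract L^p and converge uniformly for continuous x,
  hence converge to x in L^p.
*)
theory Submission
  imports Defs "HOL-Complex_Analysis.Complex_Analysis"
begin

text \<open>Nodes are numbered as in a binary heap: \<open>dyad n\<close> is the support of
  \<open>haar_n n\<close>, with left half \<open>dyad (2 * n)\<close> and right half
  \<open>dyad (Suc (2 * n))\<close>. A left turn keeps the number of binary ones and a right turn
  adds one. So for fixed d \<ge> 1 a point of (0,1] meets only finitely many nodes of
  \<open>N_set d\<close>, namely q, 2 q, ..., 2^k q with q odd, and leaves the last of them to the
  right. At that point the Haar sum with coefficients a equals a(q) + ... + a(2^(k-1) q) - a(2^k q),
  so every pointwise question is a finite one. The radius R = 2^(-1/p) reflects the halving of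
  lengths along a chain: R^p = 1/2, and scaling by R^i turns the weighted norm on a chain into the
  plain l^p norm. The constants are uniform in d, but they control each x_d separately and cannot be
  added over d. The sum over d is therefore treated by telescoping to stopped averages, not by
  coefficient estimates.\<close>

section \<open>Dyadic intervals and Haar functions indexed by tree nodes\<close>

definition dyad :: "nat \<Rightarrow> real set" where
  "dyad n = {real (pos n) / 2 ^ lev n <.. (real (pos n) + 1) / 2 ^ lev n}"

lemma lev_eqI:
  assumes "2 ^ k \<le> n" "n < 2 ^ Suc k"
  shows "lev n = k"
proof -
  have "0 < n" using assms(1) by (metis gr0I not_less power_eq_0_iff le_zero_eq zero_neq_numeral)
  then have "\<lfloor>log 2 (real n)\<rfloor> = int k"
    using floor_log_nat_eq_powr_iff[of 2 n k] assms by simp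
  then show ?thesis by (simp add: lev_def)
qed

lemma lev_le: "0 < n \<Longrightarrow> 2 ^ lev n \<le> n"
  and lev_gt: "0 < n \<Longrightarrow> n < 2 ^ Suc (lev n)"
proof -
  assume n: "0 < n"
  have "0 \<le> \<lfloor>log 2 (real n)\<rfloor>" using n by simp
  then have "\<lfloor>log 2 (real n)\<rfloor> = int (lev n)" by (simp add: lev_def)
  then have "2 ^ lev n \<le> n \<and> n < 2 ^ Suc (lev n)"
    using floor_log_nat_eq_powr_iff[of 2 n "lev n"] n by simp
  then show "2 ^ lev n \<le> n" "n < 2 ^ Suc (lev n)" by auto
qed

lemma lev_double: "0 < n \<Longrightarrow> lev (2 * n) = Suc (lev n)"
  using lev_le[of n] lev_gt[of n] by (intro lev_eqI) auto

lemma lev_Suc_double: "0 < n \<Longrightarrow> lev (Suc (2 * n)) = Suc (lev n)"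
  using lev_le[of n] lev_gt[of n] by (intro lev_eqI) auto

lemma lev_one [simp]: "lev (Suc 0) = 0"
  by (rule lev_eqI) auto

lemma pos_one [simp]: "pos (Suc 0) = 0"
  by (simp add: pos_def)

lemma pos_double: "0 < n \<Longrightarrow> pos (2 * n) = 2 * pos n"
  using lev_le[of n] by (simp add: pos_def lev_double)

lemma pos_Suc_double: "0 < n \<Longrightarrow> pos (Suc (2 * n)) = Suc (2 * pos n)"
  using lev_le[of n] by (simp add: pos_def lev_Suc_double)

lemma lev_pow_mult: "0 < n \<Longrightarrow> lev (2 ^ i * n) = i + lev n"
  by (induction i) (simp_all add: lev_double mult.assoc)

lemma pos_pow_mult: "0 < n \<Longrightarrow> pos (2 ^ i * n) = 2 ^ i * pos n"
  by (induction i) (simp_all add: pos_double mult.assoc)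

lemma dyad_one: "dyad (Suc 0) = {0<..1}"
  by (simp add: dyad_def)

lemma dyad_pow_mult:
  assumes "0 < n"
  shows "dyad (2 ^ i * n) = {real (pos n) / 2 ^ lev n <.. (real (pos n) + 1 / 2 ^ i) / 2 ^ lev n}"
  unfolding dyad_def lev_pow_mult[OF assms] pos_pow_mult[OF assms]
  by (simp add: power_add field_simps)

lemma dyad_double:
  "0 < n \<Longrightarrow> dyad (2 * n) = {real (pos n) / 2 ^ lev n <.. (real (pos n) + 1/2) / 2 ^ lev n}"
  using dyad_pow_mult[of n 1] by simp

lemma dyad_Suc_double:
  assumes "0 < n"
  shows "dyad (Suc (2 * n)) = {(real (pos n) + 1/2) / 2 ^ lev n <.. (real (pos n) + 1) / 2 ^ lev n}"
  unfolding dyad_def lev_Suc_double[OF assms] pos_Suc_double[OF assms]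
  by (rule arg_cong2[of _ _ _ _ greaterThanAtMost]) (simp_all add: field_simps)

lemma dyad_Un:
  assumes "0 < n"
  shows "dyad (2 * n) \<union> dyad (Suc (2 * n)) = dyad n"
  unfolding dyad_double[OF assms] dyad_Suc_double[OF assms] dyad_def[of n]
  by (rule ivl_disj_un) (auto intro: divide_right_mono)

lemma dyad_Int: "0 < n \<Longrightarrow> dyad (2 * n) \<inter> dyad (Suc (2 * n)) = {}"
  by (auto simp: dyad_double dyad_Suc_double)

lemma dyad_double_subset: "0 < n \<Longrightarrow> dyad (2 * n) \<subseteq> dyad n"
  and dyad_Suc_double_subset: "0 < n \<Longrightarrow> dyad (Suc (2 * n)) \<subseteq> dyad n"
  using dyad_Un by blast+

lemma dyad_subset: "0 < n \<Longrightarrow> dyad n \<subseteq> {0<..1}"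
proof (induction n rule: less_induct)
  case (less n)
  show ?case
  proof (cases "n = 1")
    case True then show ?thesis by (simp add: dyad_one)
  next
    case False
    then have m: "0 < n div 2" "n div 2 < n" using less.prems by auto
    have "n = 2 * (n div 2) \<or> n = Suc (2 * (n div 2))" by presburger
    then have "dyad n \<subseteq> dyad (n div 2)"
      using dyad_double_subset[OF m(1)] dyad_Suc_double_subset[OF m(1)] by metis
    then show ?thesis using less.IH[OF m(2,1)] by blast
  qed
qed

text \<open>Since the intervals are half open, this holds at every point, endpoints included; later
  arguments see Haar functions only through membership in dyadic intervals. The left half is tested
  first, so the second branch means the right half.\<close>

lemma haar_n_eq:
  assumes "0 < n"
  shows "haar_n n t = (if t \<in> dyad (2 * n) then 1 else if t \<in> dyad n then -1 else 0)"
proof -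
  have "(0 < 2 ^ lev n * t - real (pos n)) = (real (pos n) / 2 ^ lev n < t)"
    and "(2 ^ lev n * t - real (pos n) \<le> 1/2) = (t \<le> (real (pos n) + 1/2) / 2 ^ lev n)"
    and "(2 ^ lev n * t - real (pos n) \<le> 1) = (t \<le> (real (pos n) + 1) / 2 ^ lev n)"
    by (auto simp: field_simps)
  moreover have "(real (pos n) + 1/2) / 2 ^ lev n \<le> (real (pos n) + 1) / 2 ^ lev n"
    by (simp add: divide_right_mono)
  ultimately show ?thesis
    using dyad_double[OF assms] by (auto simp: dil_def haar_def dyad_def)
qed

text \<open>The affine map of \<open>dyad n\<close> onto (0,1] sends the leftmost subinterval of
  relative length 2^-k to \<open>dyad (2 ^ k)\<close>. Only these leftmost intervals occur, because
  a first-order chaos involves only the indices 2^k.\<close>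

lemma dyad_rescale:
  assumes "0 < n"
  shows "2 ^ lev n * t - real (pos n) \<in> dyad (2 ^ k) \<longleftrightarrow> t \<in> dyad (2 ^ k * n)"
  using dyad_pow_mult[of 1 k] dyad_pow_mult[OF assms, of k]
  by (auto simp: field_simps)

lemma haar_n_rescale:
  assumes "0 < n"
  shows "haar_n (2 ^ k) (2 ^ lev n * t - real (pos n)) = haar_n (2 ^ k * n) t"
  using dyad_rescale[OF assms, of t k] dyad_rescale[OF assms, of t "Suc k"] assms
  by (simp add: haar_n_eq mult.assoc)

text \<open>This keeps the whole problem on chains: f_n is a series in h_n, h_{2n}, h_{4n}, ... with
  the same coefficients c for every n.\<close>

lemma dil_haar_chaos:
  assumes "0 < n"
  shows "dil (haar_chaos c) n t
    = (if t \<in> dyad n then (\<Sum>k. c k * haar_n (2 ^ k * n) t) else 0)"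
  unfolding dil_def[of "haar_chaos c"] haar_chaos_def haar_n_rescale[OF assms]
  by (simp add: dyad_def)

subsection \<open>The path of a point through the dyadic tree\<close>

text \<open>The node of level l whose interval contains t. Outside (0,1] the \<open>else\<close>
  branch produces the path 1, 3, 7, ..., which carries no meaning there.\<close>

primrec tpath :: "real \<Rightarrow> nat \<Rightarrow> nat" where
  "tpath t 0 = 1"
| "tpath t (Suc l) = (if t \<in> dyad (2 * tpath t l) then 2 * tpath t l else Suc (2 * tpath t l))"

lemma tpath_pos: "0 < tpath t l"
  by (induction l) auto

lemma lev_tpath: "lev (tpath t l) = l"
  by (induction l) (simp_all add: tpath_pos lev_double lev_Suc_double)

lemma mem_dyad_tpath: "t \<in> {0<..1} \<Longrightarrow> t \<in> dyad (tpath t l)"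
proof (induction l)
  case 0 then show ?case by (simp add: dyad_one)
next
  case (Suc l)
  then show ?case using dyad_Un[OF tpath_pos, of t l] by auto
qed

text \<open>By induction through the parent \<open>n div 2\<close>: the parent also contains t, and
  the two halves of its interval are disjoint. Thus all intervals containing t lie on one
  path.\<close>

lemma tpath_unique:
  assumes "0 < n" "t \<in> dyad n"
  shows "n = tpath t (lev n)"
  using assms
proof (induction n rule: less_induct)
  case (less n)
  show ?case
  proof (cases "n = 1")
    case True then show ?thesis by simp
  next
    case False
    define m where "m = n div 2"
    have m: "0 < m" "m < n" using less.prems False by (auto simp: m_def)
    have n: "n = 2 * m \<or> n = Suc (2 * m)" unfolding m_def by presburger
    have tm: "t \<in> dyad m"
      using n less.prems(2) dyad_double_subset[OF m(1)] dyad_Suc_double_subset[OF m(1)] by auto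
    have IH: "m = tpath t (lev m)" using less.IH[OF m(2,1) tm] .
    have l: "lev n = Suc (lev m)" using n m(1) by (auto simp: lev_double lev_Suc_double)
    have "t \<in> dyad (2 * m) \<longleftrightarrow> n = 2 * m"
      using n less.prems(2) dyad_Int[OF m(1)] by auto
    then show ?thesis using n IH l by auto
  qed
qed

section \<open>Binary ones along a path\<close>

definition ones :: "nat \<Rightarrow> nat" where
  "ones n = card {i. bit n i}"

lemma N_set_iff: "n \<in> N_set d \<longleftrightarrow> 0 < n \<and> ones n = d"
  by (simp add: N_set_def ones_def)

lemma ones_double: "ones (2 * n) = ones n"
proof -
  have "{i. bit (2 * n) i} = Suc ` {i. bit n i}"
  proof (intro set_eqI)
    show "i \<in> {i. bit (2 * n) i} \<longleftrightarrow> i \<in> Suc ` {i. bit n i}" for i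
      by (cases i) (auto simp: bit_double_iff)
  qed
  then show ?thesis unfolding ones_def by (simp add: card_image)
qed

lemma finite_bits: "finite {i. bit (n::nat) i}"
proof -
  have "i < n" if "bit n i" for i
  proof (rule ccontr)
    assume "\<not> i < n"
    then have "n < 2 ^ i" by (meson less_exp less_le_trans not_less)
    then show False using that by (simp add: bit_iff_odd)
  qed
  then have "{i. bit n i} \<subseteq> {..<n}" by auto
  then show ?thesis by (rule finite_subset) simp
qed

lemma ones_Suc_double: "ones (Suc (2 * n)) = Suc (ones n)"
proof -
  have "{i. bit (Suc (2 * n)) i} = insert 0 (Suc ` {i. bit n i})"
  proof (intro set_eqI)
    show "i \<in> {i. bit (Suc (2 * n)) i} \<longleftrightarrow> i \<in> insert 0 (Suc ` {i. bit n i})" for i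
      by (cases i) (auto simp: bit_Suc bit_0)
  qed
  then show ?thesis unfolding ones_def by (simp add: card_image finite_bits)
qed

lemma ones_one [simp]: "ones (Suc 0) = 1"
  using ones_Suc_double[of 0] by (simp add: ones_def)

text \<open>Left turns preserve the count and right turns raise it by one, so the nodes with a given
  count form a contiguous block of the path.\<close>

lemma ones_tpath_mono: "l \<le> l' \<Longrightarrow> ones (tpath t l) \<le> ones (tpath t l')"
  by (rule lift_Suc_mono_le) (auto simp: ones_double ones_Suc_double)

lemma ones_pow_mult: "ones (2 ^ i * n) = ones n"
  by (induction i) (simp_all add: ones_double mult.assoc)

text \<open>A path that turns left from some point on would force its point to be the excluded left
  endpoint of a dyadic interval.\<close>

lemma tpath_turns_right:
  assumes "t \<in> {0<..1}"
  shows "\<exists>l'\<ge>l. t \<in> dyad (Suc (2 * tpath t l'))"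
proof (rule ccontr)
  assume neg: "\<not> ?thesis"
  define q where "q = tpath t l"
  have q: "0 < q" by (simp add: q_def tpath_pos)
  have left: "tpath t (l + i) = 2 ^ i * q" for i
  proof (induction i)
    case 0 then show ?case by (simp add: q_def)
  next
    case (Suc i)
    have "t \<notin> dyad (Suc (2 * tpath t (l + i)))" using neg by auto
    then have "t \<in> dyad (2 * tpath t (l + i))"
      using mem_dyad_tpath[OF assms, of "l+i"] dyad_Un[OF tpath_pos, of t "l+i"] by auto
    then show ?case using Suc by simp
  qed
  define a where "a = real (pos q) / 2 ^ lev q"
  have "a < t" using mem_dyad_tpath[OF assms, of l] by (simp add: a_def q_def dyad_def)
  then obtain i where i: "(1/2) ^ i < t - a"
    using real_arch_pow_inv[of "t - a" "1/2"] by auto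
  have "t \<in> dyad (2 ^ i * q)" using mem_dyad_tpath[OF assms, of "l+i"] left by simp
  then have "t \<le> a + 1 / (2 ^ i * 2 ^ lev q)"
    using q by (simp add: dyad_pow_mult a_def add_divide_distrib)
  also have "1 / (2 ^ i * 2 ^ lev q) \<le> (1 / 2 ^ i :: real)"
    by (simp add: field_simps)
  finally show False using i by (simp add: power_one_over)
qed

text \<open>The block of nodes with d ones begins at an odd node, the root or the target of a right
  turn, continues through k left turns, and ends at the next right turn. The conclusion records that
  last turn because its target is the odd node at which the block for d + 1 begins, which drives the
  induction.\<close>

lemma tpath_in_N_set:
  assumes t: "t \<in> {0<..1}" and d: "1 \<le> d"
  shows "\<exists>q k. odd q \<and> q \<in> N_set d \<and> {m \<in> N_set d. t \<in> dyad m} = (\<lambda>i. 2 ^ i * q) ` {..k}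
    \<and> t \<in> dyad (Suc (2 * (2 ^ k * q)))"
  using d
proof (induction d rule: dec_induct)
  have step': "\<exists>k. {m \<in> N_set d. t \<in> dyad m} = (\<lambda>i. 2 ^ i * q) ` {..k}
      \<and> t \<in> dyad (Suc (2 * (2 ^ k * q)))"
    if q: "odd q" "q \<in> N_set d" "t \<in> dyad q" for q d
  proof -
    have q0: "0 < q" "ones q = d" using q(2) by (auto simp: N_set_iff)
    have pq: "tpath t (lev q) = q" using tpath_unique[OF q0(1) q(3)] by simp
    define P where "P k \<longleftrightarrow> t \<in> dyad (Suc (2 * tpath t (lev q + k)))" for k
    obtain l' where l': "lev q \<le> l'" "t \<in> dyad (Suc (2 * tpath t l'))"
      using tpath_turns_right[OF t] by blast
    then have "P (l' - lev q)" by (simp add: P_def)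
    define k where "k = (LEAST k. P k)"
    have Pk: "P k" unfolding k_def using \<open>P (l' - lev q)\<close> by (rule LeastI)
    have notP: "\<not> P i" if "i < k" for i using that not_less_Least unfolding k_def by blast
    have left: "tpath t (lev q + i) = 2 ^ i * q" if "i \<le> k" for i
      using that
    proof (induction i)
      case 0 then show ?case by (simp add: pq)
    next
      case (Suc i)
      have "t \<in> dyad (2 * tpath t (lev q + i))"
        using mem_dyad_tpath[OF t, of "lev q+i"] dyad_Un[OF tpath_pos, of t "lev q+i"]
          notP[of i] Suc.prems by (auto simp: P_def)
      then show ?case using Suc by simp
    qed
    have turn: "tpath t (Suc (lev q + k)) = Suc (2 * (2 ^ k * q))"
      using Pk left[of k] dyad_Int[OF tpath_pos, of t "lev q + k"] by (auto simp: P_def)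
    have "{m \<in> N_set d. t \<in> dyad m} = (\<lambda>i. 2 ^ i * q) ` {..k}"
    proof (intro equalityI subsetI)
      fix m assume "m \<in> {m \<in> N_set d. t \<in> dyad m}"
      then have m: "0 < m" "ones m = d" "t \<in> dyad m" by (auto simp: N_set_iff)
      have pm: "tpath t (lev m) = m" using tpath_unique[OF m(1,3)] by simp
      have "lev m \<le> lev q + k"
      proof (rule ccontr)
        assume "\<not> ?thesis"
        then have "ones (tpath t (Suc (lev q + k))) \<le> ones m"
          using ones_tpath_mono[of "Suc (lev q + k)" "lev m" t] pm by simp
        then show False using m(2) q0 unfolding turn by (simp add: ones_Suc_double ones_pow_mult)
      qed
      \<comment> \<open>If q is not the root, then being odd it was entered by a right turn, so
        every node above it on the path has fewer than d ones.\<close>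
      moreover have "lev q \<le> lev m"
      proof (rule ccontr)
        assume less: "\<not> ?thesis"
        then obtain l where l: "lev q = Suc l" "lev m \<le> l" by (cases "lev q") auto
        have "q = Suc (2 * tpath t l)" using pq q(1) unfolding l(1) by (auto split: if_splits)
        then have "d = Suc (ones (tpath t l))" using q0 by (simp add: ones_Suc_double)
        moreover have "d \<le> ones (tpath t l)" using ones_tpath_mono[OF l(2), of t] pm m(2) by simp
        ultimately show False by simp
      qed
      ultimately obtain i where "lev m = lev q + i" "i \<le> k" by (metis le_iff_add add_le_cancel_left)
      then show "m \<in> (\<lambda>i. 2 ^ i * q) ` {..k}" using left[of i] pm by (metis atMost_iff imageI)
    next
      fix m assume "m \<in> (\<lambda>i. 2 ^ i * q) ` {..k}"
      then obtain i where i: "i \<le> k" "m = 2 ^ i * q" by auto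
      then have "t \<in> dyad m" using mem_dyad_tpath[OF t, of "lev q + i"] left[of i] by simp
      then show "m \<in> {m \<in> N_set d. t \<in> dyad m}" using i q0 by (simp add: N_set_iff ones_pow_mult)
    qed
    moreover have "t \<in> dyad (Suc (2 * (2 ^ k * q)))" using Pk left[of k] by (simp add: P_def)
    ultimately show ?thesis by blast
  qed
  {
    case base
    have "odd (1::nat)" "1 \<in> N_set 1" "t \<in> dyad 1" using t by (auto simp: N_set_iff dyad_one)
    from step'[OF this] show ?case using \<open>odd 1\<close> \<open>1 \<in> N_set 1\<close> by blast
  next
    case (step n)
    then obtain q k where q: "q \<in> N_set n" "t \<in> dyad (Suc (2 * (2 ^ k * q)))" by blast
    have "odd (Suc (2 * (2 ^ k * q)))" "Suc (2 * (2 ^ k * q)) \<in> N_set (Suc n)"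
      using q by (auto simp: N_set_iff ones_Suc_double ones_pow_mult)
    from step'[OF this q(2)] this show ?case by blast
  }
qed

text \<open>A block q, 2 q, ..., 2^k q has q as its only odd member. Hence the intervals of the odd
  nodes of \<open>N_set d\<close> are pairwise disjoint, the form of disjointness used in the energy
  estimates.\<close>

lemma odd_dyad_unique:
  assumes "odd q" "q \<in> N_set d" "t \<in> dyad q" and "odd q'" "q' \<in> N_set d" "t \<in> dyad q'"
  shows "q = q'"
proof -
  have "0 < q" using assms by (auto simp: N_set_iff)
  then have t: "t \<in> {0<..1}" using assms dyad_subset by blast
  have "1 \<le> d"
    using assms ones_tpath_mono[of 0 "lev q" t] tpath_unique[of q t] by (auto simp: N_set_iff)
  then obtain r k where r: "{m \<in> N_set d. t \<in> dyad m} = (\<lambda>i. 2 ^ i * r) ` {..k}"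
    using tpath_in_N_set[OF t] by blast
  have "x = r" if "odd x" "x \<in> N_set d" "t \<in> dyad x" for x
  proof -
    have "x \<in> (\<lambda>i. 2 ^ i * r) ` {..k}" using that r by blast
    then obtain i where "x = 2 ^ i * r" by blast
    then show ?thesis using that(1) by (cases i) auto
  qed
  then show ?thesis using assms by metis
qed

subsection \<open>Haar sums and convolution along the chains n, 2 n, 4 n, ...\<close>

text \<open>Indexing by the nodes that contain t makes this a finite sum at each t in (0,1] when d
  \<ge> 1; the omitted Haar functions vanish at t.\<close>

definition haar_sum :: "nat \<Rightarrow> (nat \<Rightarrow> complex) \<Rightarrow> real \<Rightarrow> complex" where
  "haar_sum d a t = (\<Sum>m \<in> {m \<in> N_set d. t \<in> dyad m}. a m * haar_n m t)"

text \<open>The multiplicity of 2 in n is the position of n on its chain, counted from 0 at the odd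
  node, so the sum runs over n and all its predecessors.\<close>

definition chain_conv :: "(nat \<Rightarrow> complex) \<Rightarrow> (nat \<Rightarrow> complex) \<Rightarrow> nat \<Rightarrow> complex" where
  "chain_conv c a n = (\<Sum>j = 0..multiplicity (2::nat) n. c j * a (n div 2 ^ j))"

text \<open>Starting at j = 1 leaves out n itself: only strict predecessors count, since h_n takes
  the value 1 on the chain before the last node and -1 at it.\<close>

definition chain_sum :: "(nat \<Rightarrow> complex) \<Rightarrow> nat \<Rightarrow> complex" where
  "chain_sum a n = (\<Sum>j = 1..multiplicity (2::nat) n. a (n div 2 ^ j))"

lemma multiplicity_pow_mult_odd: "odd q \<Longrightarrow> multiplicity 2 (2 ^ i * q :: nat) = i"
  by (rule multiplicity_eqI) auto

lemma pow_mult_odd_cases: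
  assumes "0 < (n::nat)"
  obtains i q where "odd q" "n = 2 ^ i * q"
proof -
  obtain y where "n = 2 ^ multiplicity 2 n * y" "\<not> 2 dvd y"
    using multiplicity_decompose'[of n 2] assms by auto
  then show thesis using that by blast
qed

lemma pow_mult_div: "j \<le> i \<Longrightarrow> 2 ^ i * q div 2 ^ j = (2 ^ (i - j) * q :: nat)"
  by (metis (no_types, lifting) le_add_diff_inverse mult.assoc nonzero_mult_div_cancel_left
      power_add power_not_zero zero_neq_numeral)

text \<open>On the chain of an odd q the operation is multiplication of formal power series, so
  associativity and inversion are inherited from that ring.\<close>

lemma chain_conv_pow_mult:
  assumes "odd q"
  shows "chain_conv c a (2 ^ i * q) = fps_nth (Abs_fps c * Abs_fps (\<lambda>k. a (2 ^ k * q))) i"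
  unfolding chain_conv_def fps_mult_nth multiplicity_pow_mult_odd[OF assms]
  by (intro sum.cong) (auto simp: pow_mult_div)

lemma chain_conv_inverse:
  assumes "Abs_fps c * Abs_fps d = 1" "0 < n"
  shows "chain_conv c (chain_conv d a) n = a n"
proof -
  obtain i q where q: "odd q" "n = 2 ^ i * q" using pow_mult_odd_cases[OF assms(2)] .
  have "Abs_fps (\<lambda>k. chain_conv d a (2 ^ k * q)) = Abs_fps d * Abs_fps (\<lambda>k. a (2 ^ k * q))"
    by (rule fps_ext) (simp add: chain_conv_pow_mult[OF q(1)])
  then have "chain_conv c (chain_conv d a) n
      = fps_nth (Abs_fps c * Abs_fps d * Abs_fps (\<lambda>k. a (2 ^ k * q))) i"
    by (simp add: q(2) chain_conv_pow_mult[OF q(1)] mult.assoc)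
  then show ?thesis by (simp add: assms(1) q(2))
qed

lemma chain_conv_diff: "chain_conv c (\<lambda>n. a n - b n) n = chain_conv c a n - chain_conv c b n"
  by (simp add: chain_conv_def right_diff_distrib sum_subtractf)

lemma chain_sum_pow_mult:
  assumes "odd q"
  shows "chain_sum a (2 ^ i * q) = (\<Sum>j<i. a (2 ^ j * q))"
  unfolding chain_sum_def multiplicity_pow_mult_odd[OF assms]
  by (rule sum.reindex_bij_witness[of _ "\<lambda>j. i - j" "\<lambda>j. i - j"]) (auto simp: pow_mult_div)

lemma chain_sum_double:
  assumes "0 < n"
  shows "chain_sum a (2 * n) = chain_sum a n + a n"
proof -
  obtain i q where q: "odd q" "n = 2 ^ i * q" using pow_mult_odd_cases[OF assms] .
  show ?thesis
    using chain_sum_pow_mult[OF q(1), of a "Suc i"] chain_sum_pow_mult[OF q(1), of a i]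
    by (simp add: q(2) mult.assoc)
qed

lemma chain_sum_odd: "odd n \<Longrightarrow> chain_sum a n = 0"
  using chain_sum_pow_mult[of n a 0] by simp

text \<open>The intervals \<open>dyad (2 ^ i * q)\<close> decrease in i, and t belongs to exactly
  those with i \<le> k. So t lies in the left half of each of the first k, in the right half of the
  one with i = k, and outside the rest.\<close>

lemma haar_n_on_chain:
  assumes "0 < q" "t \<in> dyad (Suc (2 * (2 ^ k * q)))"
  shows "haar_n (2 ^ i * q) t = (if i < k then 1 else if i = k then -1 else 0)"
proof -
  have sub: "dyad (2 ^ j * q) \<subseteq> dyad (2 ^ i * q)" if "i \<le> j" for i j
  proof -
    have "(1::real) / 2 ^ j \<le> 1 / 2 ^ i" using that by (simp add: field_simps)
    then have "(real (pos q) + 1 / 2 ^ j) / 2 ^ lev q \<le> (real (pos q) + 1 / 2 ^ i) / 2 ^ lev q"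
      by (intro divide_right_mono add_left_mono) auto
    then show ?thesis using assms(1) by (auto simp: dyad_pow_mult)
  qed
  have 0: "0 < 2 ^ k * q" using assms(1) by simp
  have tk: "t \<in> dyad (2 ^ k * q)" "t \<notin> dyad (2 ^ Suc k * q)"
    using assms(2) dyad_Un[OF 0] dyad_Int[OF 0] by (auto simp: mult.assoc)
  have "t \<in> dyad (2 ^ i * q) \<longleftrightarrow> i \<le> k" for i
    using sub[of i k] sub[of "Suc k" i] tk by (meson not_less_eq_eq subsetD)
  from this[of i] this[of "Suc i"] show ?thesis
    using assms(1) by (auto simp: haar_n_eq mult.assoc)
qed

text \<open>Bundles the output of \<open>tpath_in_N_set\<close> for one point t. It is interpreted
  pointwise, with q and k depending on t.\<close>

locale path_data =
  fixes d q k :: nat and t :: real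
  assumes odd_q: "odd q" and q_N: "q \<in> N_set d"
    and met: "{m \<in> N_set d. t \<in> dyad m} = (\<lambda>i. 2 ^ i * q) ` {..k}"
    and turn: "t \<in> dyad (Suc (2 * (2 ^ k * q)))"
begin

lemma q_pos: "0 < q"
  using odd_q by (cases q) auto

lemma inj_chain: "inj_on (\<lambda>i. 2 ^ i * q) A"
  by (rule inj_onI) (use q_pos in auto)

lemma haar_sum_eq: "haar_sum d a t = (\<Sum>i<k. a (2 ^ i * q)) - a (2 ^ k * q)"
proof -
  have "haar_sum d a t = (\<Sum>i\<le>k. a (2 ^ i * q) * haar_n (2 ^ i * q) t)"
    unfolding haar_sum_def met by (simp add: sum.reindex[OF inj_chain])
  also have "\<dots> = (\<Sum>i<k. a (2 ^ i * q) * haar_n (2 ^ i * q) t)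
      + a (2 ^ k * q) * haar_n (2 ^ k * q) t"
    by (simp flip: lessThan_Suc_atMost)
  also have "\<dots> = (\<Sum>i<k. a (2 ^ i * q)) - a (2 ^ k * q)"
    by (simp add: haar_n_on_chain[OF q_pos turn])
  finally show ?thesis .
qed

text \<open>The value depends only on the last node n = 2^k q, so the Haar sum is constant on the
  right half of \<open>dyad n\<close>. These right halves, for n in \<open>N_set d\<close>,
  partition (0,1].\<close>

lemma haar_sum_chain_sum: "haar_sum d a t = chain_sum a (2 ^ k * q) - a (2 ^ k * q)"
  by (simp add: haar_sum_eq chain_sum_pow_mult[OF odd_q])

text \<open>Meant for A the dyadic averages of x and a its Haar coefficients. Left turns add a, the
  final right turn subtracts it, which are exactly the signs in \<open>haar_sum_eq\<close>.\<close>

lemma haar_sum_telescope: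
  assumes "\<And>n. 0 < n \<Longrightarrow> A (2 * n) = A n + a n"
    and "\<And>n. 0 < n \<Longrightarrow> A (Suc (2 * n)) = A n - a n"
  shows "haar_sum d a t = A (Suc (2 * (2 ^ k * q))) - A q"
proof -
  have "A (2 ^ i * q) = A q + (\<Sum>j<i. a (2 ^ j * q))" for i
    by (induction i) (use q_pos assms(1) in \<open>auto simp: mult.assoc\<close>)
  then show ?thesis using assms(2)[of "2 ^ k * q"] q_pos by (simp add: haar_sum_eq)
qed

text \<open>At t only h_n with n = 2^m q and m \<le> k survive, so the series for each f_n is
  finite. Regrouping the terms from position i and shift l by m = i + l gives the convolution; the
  cutoff n < N is moved into the coefficients.\<close>

lemma partial_sum_eq:
  "(\<Sum>n \<in> {n \<in> N_set d. n < N}. y n * dil (haar_chaos c) n t)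
    = haar_sum d (chain_conv c (\<lambda>n. if n < N then y n else 0)) t"
proof -
  define y' where "y' n = (if n < N then y n else 0)" for n
  define h where "h i = haar_n (2 ^ i * q) t" for i
  have h0: "h i = 0" if "k < i" for i using that by (simp add: h_def haar_n_on_chain[OF q_pos turn])
  have "(\<Sum>n \<in> {n \<in> N_set d. n < N}. y n * dil (haar_chaos c) n t)
      = (\<Sum>n \<in> {n \<in> N_set d. t \<in> dyad n} \<inter> {n. n < N}. y n * dil (haar_chaos c) n t)"
    by (rule sum.mono_neutral_right) (auto simp: dil_haar_chaos N_set_iff)
  also have "\<dots> = (\<Sum>n \<in> {n \<in> N_set d. t \<in> dyad n}. y' n * dil (haar_chaos c) n t)"
    by (rule sum.mono_neutral_cong_left) (auto simp: y'_def met)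
  also have "\<dots> = (\<Sum>i\<le>k. y' (2 ^ i * q) * dil (haar_chaos c) (2 ^ i * q) t)"
    unfolding met by (simp add: sum.reindex[OF inj_chain])
  also have "\<dots> = (\<Sum>i\<le>k. y' (2 ^ i * q) * (\<Sum>l\<le>k - i. c l * h (l + i)))"
  proof (rule sum.cong)
    fix i assume "i \<in> {..k}"
    then have "2 ^ i * q \<in> {m \<in> N_set d. t \<in> dyad m}" unfolding met by blast
    then have "dil (haar_chaos c) (2 ^ i * q) t = (\<Sum>l. c l * h (l + i))"
      using q_pos by (simp add: dil_haar_chaos h_def power_add mult.assoc)
    also have "\<dots> = (\<Sum>l\<le>k - i. c l * h (l + i))"
      using h0 by (intro suminf_finite) auto
    finally show "y' (2 ^ i * q) * dil (haar_chaos c) (2 ^ i * q) t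
        = y' (2 ^ i * q) * (\<Sum>l\<le>k - i. c l * h (l + i))" by simp
  qed simp
  \<comment> \<open>The double sum fills the triangle i + l \<le> k and can be summed along its
    antidiagonals.\<close>
  also have "\<dots> = (\<Sum>(i, l) \<in> {(i, l). i + l \<le> k}. y' (2 ^ i * q) * c l * h (l + i))"
    unfolding sum_distrib_left
    by (subst sum.Sigma) (auto intro!: sum.cong simp: mult.assoc)
  also have "\<dots> = (\<Sum>m\<le>k. \<Sum>i\<le>m. y' (2 ^ i * q) * c (m - i) * h (m - i + i))"
    by (rule sum.triangle_reindex_eq)
  also have "\<dots> = (\<Sum>m\<le>k. chain_conv c y' (2 ^ m * q) * h m)"
    unfolding chain_conv_pow_mult[OF odd_q] mult.commute[of "Abs_fps c"] fps_mult_nth sum_distrib_right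
    by (intro sum.cong) (auto simp: atLeast0AtMost)
  also have "\<dots> = haar_sum d (chain_conv c y') t"
    unfolding haar_sum_def met by (simp add: sum.reindex[OF inj_chain] h_def)
  finally show ?thesis by (simp add: y'_def [abs_def])
qed

end

lemma path_data_exists:
  assumes "t \<in> {0<..1}" "1 \<le> d"
  obtains q k where "path_data d q k t"
  using tpath_in_N_set[OF assms] unfolding path_data_def by blast

lemma haar_sum_diff: "haar_sum d (\<lambda>n. a n - b n) t = haar_sum d a t - haar_sum d b t"
  by (simp add: haar_sum_def left_diff_distrib sum_subtractf)

text \<open>The stopping time: the node at which the path of \<open>t\<close> has made \<open>d\<close> right turns
  (the root counting as the first one).\<close>

definition stop :: "nat \<Rightarrow> real \<Rightarrow> nat" where
  "stop d t = (THE q. odd q \<and> q \<in> N_set d \<and> t \<in> dyad q)"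

lemma stop_eqI: "odd q \<Longrightarrow> q \<in> N_set d \<Longrightarrow> t \<in> dyad q \<Longrightarrow> stop d t = q"
  unfolding stop_def by (rule the_equality) (auto intro: odd_dyad_unique)

lemma stop_props:
  assumes "t \<in> {0<..1}" "1 \<le> d"
  shows "odd (stop d t)" "stop d t \<in> N_set d" "t \<in> dyad (stop d t)"
proof -
  obtain q k where "path_data d q k t" using path_data_exists[OF assms] .
  then interpret path_data d q k t .
  have "q \<in> (\<lambda>i. 2 ^ i * q) ` {..k}" by (rule image_eqI[of _ _ 0]) auto
  then have "t \<in> dyad q" using met by blast
  then show "odd (stop d t)" "stop d t \<in> N_set d" "t \<in> dyad (stop d t)"
    using stop_eqI[OF odd_q q_N] odd_q q_N by auto
qed

text \<open>The block for D + 1 starts at the node where the sum for D ended, so consecutive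
  differences of A cancel; the index \<open>Suc D\<close> arises because the root already counts as
  the first right turn.\<close>

lemma sum_haar_sum_telescope:
  assumes t: "t \<in> {0<..1}"
    and "\<And>n. 0 < n \<Longrightarrow> A (2 * n) = A n + a n"
    and "\<And>n. 0 < n \<Longrightarrow> A (Suc (2 * n)) = A n - a n"
  shows "(\<Sum>d = 1..D. haar_sum d a t) = A (stop (Suc D) t) - A 1"
proof (induction D)
  case 0
  have "stop (Suc 0) t = 1"
    by (rule stop_eqI) (use t in \<open>auto simp: N_set_iff dyad_one\<close>)
  then show ?case by simp
next
  case (Suc D)
  obtain q k where "path_data (Suc D) q k t" using path_data_exists[OF t, of "Suc D"] by auto
  then interpret path_data "Suc D" q k t .
  have "q \<in> (\<lambda>i. 2 ^ i * q) ` {..k}" by (rule image_eqI[of _ _ 0]) auto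
  then have "t \<in> dyad q" using met by blast
  then have 1: "stop (Suc D) t = q" using odd_q q_N by (intro stop_eqI)
  have 2: "stop (Suc (Suc D)) t = Suc (2 * (2 ^ k * q))"
    using turn q_N by (intro stop_eqI) (auto simp: N_set_iff ones_Suc_double ones_pow_mult)
  show ?case using Suc haar_sum_telescope[of A a] assms 1 2 by simp
qed

subsection \<open>Multipliers of weighted \<open>\<ell>\<^sup>p\<close>\<close>

text \<open>According to whether b \<le> e a or not, the sum is at most (1 + e) a or (1 + 1/e) b.
  The point is that the factor of the first term tends to 1 as e tends to 0, so a contraction in
  that term survives.\<close>

lemma powr_add_le_weighted:
  fixes a b e p :: real
  assumes "0 \<le> a" "0 \<le> b" "0 < e" "0 < p"
  shows "(a + b) powr p \<le> (1 + e) powr p * a powr p + (1 + 1/e) powr p * b powr p"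
proof (cases "b \<le> e * a")
  case True
  then have "(a + b) powr p \<le> ((1 + e) * a) powr p"
    using assms by (intro powr_mono2) (auto simp: algebra_simps)
  also have "\<dots> \<le> (1 + e) powr p * a powr p + (1 + 1/e) powr p * b powr p"
    using assms by (simp add: powr_mult)
  finally show ?thesis .
next
  case False
  then have "(a + b) powr p \<le> ((1 + 1/e) * b) powr p"
    using assms by (intro powr_mono2) (auto simp: field_simps)
  also have "\<dots> \<le> (1 + e) powr p * a powr p + (1 + 1/e) powr p * b powr p"
    using assms by (simp add: powr_mult)
  finally show ?thesis .
qed

lemma norm_add_powr_le_weighted:
  fixes x y :: "'a::real_normed_vector"
  assumes "0 < e" "0 < p"
  shows "norm (x + y) powr p \<le> (1 + e) powr p * norm x powr p + (1 + 1/e) powr p * norm y powr p"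
proof -
  have "norm (x + y) powr p \<le> (norm x + norm y) powr p"
    using assms by (intro powr_mono2) (auto intro: norm_triangle_ineq)
  also have "\<dots> \<le> (1 + e) powr p * norm x powr p + (1 + 1/e) powr p * norm y powr p"
    using assms by (intro powr_add_le_weighted) auto
  finally show ?thesis .
qed

lemma norm_add_powr_le:
  fixes x y :: "'a::real_normed_vector"
  assumes "0 < p"
  shows "norm (x + y) powr p \<le> 2 powr p * (norm x powr p + norm y powr p)"
  using norm_add_powr_le_weighted[of 1 p x y] assms by (simp add: algebra_simps)

lemma norm_diff_powr_le:
  fixes x y :: "'a::real_normed_vector"
  assumes "0 < p"
  shows "norm (x - y) powr p \<le> 2 powr p * (norm x powr p + norm y powr p)"
  using norm_add_powr_le[OF assms, of x "- y"] by simp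

lemma sum_lessThan_add:
  fixes f :: "nat \<Rightarrow> 'a::comm_monoid_add"
  shows "sum f {..<m + n} = sum f {..<m} + (\<Sum>k<n. f (m + k))"
  by (induction n) (simp_all add: add.assoc)

lemma conv_cong_le:
  fixes \<alpha> v w :: "nat \<Rightarrow> complex"
  assumes "\<And>j. j \<le> k \<Longrightarrow> v j = w j"
  shows "fps_nth (Abs_fps \<alpha> * Abs_fps v) k = fps_nth (Abs_fps \<alpha> * Abs_fps w) k"
  unfolding fps_mult_nth by (intro sum.cong) (auto simp: assms)

text \<open>Closed-graph argument by gliding hump: if truncations of the convolution were unbounded, one
  could append to a finite sequence a far translate of a small sequence with large convolution,
  again and again, and obtain a sequence in \<open>\<ell>\<^sup>p\<close> whose convolution is not.\<close>

lemma gliding_hump_step: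
  fixes \<alpha> A :: "nat \<Rightarrow> complex" and p :: real
  defines "F \<equiv> \<lambda>v k. fps_nth (Abs_fps \<alpha> * Abs_fps v) k"
  assumes p: "0 < p"
    and mult: "\<And>v. summable (\<lambda>k. norm (v k) powr p) \<Longrightarrow> summable (\<lambda>k. norm (F v k) powr p)"
    and unb: "\<And>C. 0 \<le> C \<Longrightarrow> \<exists>v n. C * (\<Sum>k<n. norm (v k) powr p) < (\<Sum>k<n. norm (F v k) powr p)"
    and A: "\<And>k. N \<le> k \<Longrightarrow> A k = 0"
  shows "\<exists>A' N'. N < N' \<and> (\<forall>k<N. A' k = A k) \<and> (\<forall>k\<ge>N'. A' k = 0)
    \<and> (\<Sum>k<N'. norm (A' k) powr p) \<le> (\<Sum>k<N. norm (A k) powr p) + (1/2) ^ j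
    \<and> real j \<le> (\<Sum>k<N'. norm (F A' k) powr p)"
proof -
  have "summable (\<lambda>k. norm (A k) powr p)"
    by (rule summable_finite[of "{..<N}"]) (use A in auto)
  then have sF: "summable (\<lambda>k. norm (F A k) powr p)" by (rule mult)
  define K where "K = (\<Sum>k. norm (F A k) powr p)"
  have K0: "0 \<le> K" unfolding K_def by (intro suminf_nonneg sF) auto
  \<comment> \<open>After v is rescaled to p-mass 2^-j, its convolution has p-mass above 2^p (j +
    K). The factor 2^p pays for the splitting of a difference, and K for the overlap with the
    convolution of the old sequence A.\<close>
  define C where "C = 2 powr p * 2 ^ j * (real j + K)"
  have "0 \<le> C" using K0 by (simp add: C_def)
  from unb[OF this] obtain v n
    where vn: "C * (\<Sum>k<n. norm (v k) powr p) < (\<Sum>k<n. norm (F v k) powr p)" by blast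
  define s where "s = (\<Sum>k<n. norm (v k) powr p)"
  have n0: "0 < n" using vn by (cases n) auto
  have s0: "0 < s"
  proof (rule ccontr)
    assume "\<not> 0 < s"
    moreover have "0 \<le> s" unfolding s_def by (intro sum_nonneg) auto
    ultimately have "s = 0" by simp
    then have "\<forall>k<n. norm (v k) powr p = 0"
      unfolding s_def by (subst (asm) sum_nonneg_eq_0_iff) auto
    then have v0: "v k = 0" if "k < n" for k using that by simp
    have "F v k = 0" if "k < n" for k
      unfolding F_def fps_mult_nth by (rule sum.neutral) (use v0 that in auto)
    then have "(\<Sum>k<n. norm (F v k) powr p) = 0" by simp
    then show False using vn \<open>s = 0\<close> by (simp add: s_def)
  qed
  define \<epsilon> where "\<epsilon> = ((1/2) ^ j / s) powr (1/p)"
  have eps: "\<epsilon> powr p = (1/2) ^ j / s" "0 \<le> \<epsilon>"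
    using s0 p by (auto simp: \<epsilon>_def powr_powr)
  define A' where "A' k = (if k < N then A k else if k < N + n then \<epsilon> * v (k - N) else 0)" for k
  have "(\<Sum>k<N+n. norm (A' k) powr p)
      = (\<Sum>k<N. norm (A' k) powr p) + (\<Sum>k<n. norm (A' (N + k)) powr p)"
    by (simp add: sum_lessThan_add)
  also have "\<dots> = (\<Sum>k<N. norm (A k) powr p) + \<epsilon> powr p * s"
    using eps(2) by (simp add: A'_def s_def sum_distrib_left norm_mult powr_mult)
  finally have nA': "(\<Sum>k<N+n. norm (A' k) powr p) \<le> (\<Sum>k<N. norm (A k) powr p) + (1/2) ^ j"
    using s0 eps by simp
  \<comment> \<open>Convolution commutes with the shift by N, and up to index N + n the sequence A'
    agrees with A plus the shifted and scaled v.\<close>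
  have FA': "F A' (N + k) = F A (N + k) + \<epsilon> * F v k" if "k < n" for k
  proof -
    have "F A' (N + k) = fps_nth (Abs_fps \<alpha> *
        Abs_fps (\<lambda>i. fps_nth (Abs_fps A + fps_X ^ N * (fps_const (of_real \<epsilon>) * Abs_fps v)) i)) (N + k)"
      unfolding F_def
      by (rule conv_cong_le) (use that A in \<open>auto simp: A'_def fps_X_power_mult_nth\<close>)
    also have "\<dots> = fps_nth (Abs_fps \<alpha> * (Abs_fps A + fps_X ^ N * (fps_const (of_real \<epsilon>) * Abs_fps v))) (N + k)"
      by (simp only: fps_nth_inverse)
    also have "Abs_fps \<alpha> * (Abs_fps A + fps_X ^ N * (fps_const (of_real \<epsilon>) * Abs_fps v))
        = Abs_fps \<alpha> * Abs_fps A + fps_X ^ N * (fps_const (of_real \<epsilon>) * (Abs_fps \<alpha> * Abs_fps v))"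
      by (simp add: algebra_simps)
    finally show ?thesis by (simp add: F_def fps_X_power_mult_nth)
  qed
  have "2 powr p * (real j + K) = \<epsilon> powr p * (C * s)"
    using s0 by (simp add: eps C_def power_one_over)
  also have "\<dots> \<le> \<epsilon> powr p * (\<Sum>k<n. norm (F v k) powr p)"
    using vn by (intro mult_left_mono) (auto simp: s_def)
  also have "\<dots> = (\<Sum>k<n. norm (\<epsilon> * F v k) powr p)"
    using eps(2) by (simp add: sum_distrib_left norm_mult powr_mult)
  also have "\<dots> = (\<Sum>k<n. norm (F A' (N + k) - F A (N + k)) powr p)"
    by (intro sum.cong) (auto simp: FA')
  also have "\<dots> \<le> (\<Sum>k<n. 2 powr p * (norm (F A' (N + k)) powr p + norm (F A (N + k)) powr p))"
    by (intro sum_mono norm_diff_powr_le p)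
  also have "\<dots> = 2 powr p * ((\<Sum>k<n. norm (F A' (N + k)) powr p) + (\<Sum>k<n. norm (F A (N + k)) powr p))"
    by (simp add: sum_distrib_left[symmetric] sum.distrib)
  finally have "real j + K \<le> (\<Sum>k<n. norm (F A' (N + k)) powr p) + (\<Sum>k<n. norm (F A (N + k)) powr p)"
    by simp
  also have "(\<Sum>k<n. norm (F A' (N + k)) powr p) \<le> (\<Sum>k<N+n. norm (F A' k) powr p)"
    by (simp add: sum_lessThan_add sum_nonneg)
  also have "(\<Sum>k<n. norm (F A (N + k)) powr p) \<le> (\<Sum>k<N+n. norm (F A k) powr p)"
    by (simp add: sum_lessThan_add sum_nonneg)
  also have "\<dots> \<le> K" unfolding K_def by (intro sum_le_suminf sF) auto
  finally have "real j \<le> (\<Sum>k<N+n. norm (F A' k) powr p)" by simp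
  then show ?thesis using n0 nA'
    by (intro exI[of _ A'] exI[of _ "N+n"]) (auto simp: A'_def)
qed

text \<open>Convolution up to index n sees only the entries below n, so the bound can be stated for
  finite sections, and thus for arbitrary v. This is what permits its use on truncated
  chains.\<close>

lemma multiplier_bounded:
  fixes \<alpha> :: "nat \<Rightarrow> complex" and p :: real
  defines "F \<equiv> \<lambda>v k. fps_nth (Abs_fps \<alpha> * Abs_fps v) k"
  assumes p: "0 < p"
    and mult: "\<And>v. summable (\<lambda>k. norm (v k) powr p) \<Longrightarrow> summable (\<lambda>k. norm (F v k) powr p)"
  shows "\<exists>C\<ge>0. \<forall>v n. (\<Sum>k<n. norm (F v k) powr p) \<le> C * (\<Sum>k<n. norm (v k) powr p)"
proof (rule ccontr)
  assume "\<not> ?thesis"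
  then have unb: "\<exists>v n. C * (\<Sum>k<n. norm (v k) powr p) < (\<Sum>k<n. norm (F v k) powr p)" if "0 \<le> C" for C
    using that by (meson not_le)
  note step = gliding_hump_step[OF p mult[unfolded F_def] unb[unfolded F_def]]
  have "\<exists>s. \<forall>j. (\<forall>k\<ge>snd (s j). fst (s j) k = 0) \<and>
     (snd (s j) < snd (s (Suc j)) \<and> (\<forall>k<snd (s j). fst (s (Suc j)) k = fst (s j) k)
    \<and> (\<Sum>k<snd (s (Suc j)). norm (fst (s (Suc j)) k) powr p) \<le> (\<Sum>k<snd (s j). norm (fst (s j) k) powr p) + (1/2) ^ j
    \<and> real j \<le> (\<Sum>k<snd (s (Suc j)). norm (F (fst (s (Suc j))) k) powr p))"
    (is "\<exists>s. \<forall>j. ?P (s j) \<and> ?Q j (s j) (s (Suc j))")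
  proof (rule dependent_nat_choice)
    show "\<exists>x :: (nat \<Rightarrow> complex) \<times> nat. \<forall>k\<ge>snd x. fst x k = 0" by (rule exI[of _ "((\<lambda>_. 0), 0::nat)"]) simp
  next
    fix x :: "(nat \<Rightarrow> complex) \<times> nat" and j :: nat
    assume "\<forall>k\<ge>snd x. fst x k = 0"
    then obtain A' N' where "snd x < N' \<and> (\<forall>k<snd x. A' k = fst x k) \<and> (\<forall>k\<ge>N'. A' k = 0)
      \<and> (\<Sum>k<N'. norm (A' k) powr p) \<le> (\<Sum>k<snd x. norm (fst x k) powr p) + (1/2) ^ j
      \<and> real j \<le> (\<Sum>k<N'. norm (F A' k) powr p)"
      using step[of "snd x" "fst x" j] by (auto simp: F_def)
    then show "\<exists>y. (\<forall>k\<ge>snd y. fst y k = 0) \<and>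
       (snd x < snd y \<and> (\<forall>k<snd x. fst y k = fst x k)
    \<and> (\<Sum>k<snd y. norm (fst y k) powr p) \<le> (\<Sum>k<snd x. norm (fst x k) powr p) + (1/2) ^ j
    \<and> real j \<le> (\<Sum>k<snd y. norm (F (fst y) k) powr p))"
      by (intro exI[of _ "(A', N')"]) simp
  qed
  then obtain s where s: "\<And>j. ?P (s j) \<and> ?Q j (s j) (s (Suc j))" by blast
  define A where "A j = fst (s j)" for j
  define N where "N j = snd (s j)" for j
  have A1: "A (Suc j) k = A j k" if "k < N j" for j k using s[of j] that by (auto simp: A_def N_def)
  have N1: "N j < N (Suc j)" for j using s[of j] by (auto simp: N_def)
  have S1: "(\<Sum>k<N (Suc j). norm (A (Suc j) k) powr p) \<le> (\<Sum>k<N j. norm (A j k) powr p) + (1/2) ^ j" for j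
    using s[of j] by (auto simp: A_def N_def)
  have F1: "real j \<le> (\<Sum>k<N (Suc j). norm (F (A (Suc j)) k) powr p)" for j
    using s[of j] by (auto simp: A_def N_def)
  have Nmono: "strict_mono N" by (rule strict_monoI_Suc) (rule N1)
  then have Nge: "j \<le> N j" for j by (rule strict_mono_imp_increasing)
  have stable: "A (j + i) k = A j k" if "k < N j" for i j k
  proof (induction i)
    case (Suc i)
    have "N j \<le> N (j + i)" using Nmono by (simp add: strict_mono_less_eq)
    then show ?case using Suc A1[of k "j+i"] that by simp
  qed simp
  \<comment> \<open>Since \<open>N (Suc k)\<close> exceeds k, entry k is frozen from stage
    \<open>Suc k\<close> on; w is the limit of the stages.\<close>
  define w where "w k = A (Suc k) k" for k
  have w: "w k = A j k" if "k < N j" for j k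
  proof -
    have "k < N (Suc k)" using Nge[of "Suc k"] by simp
    then show ?thesis using stable[of k j "Suc k"] stable[of k "Suc k" j] that
      by (simp add: w_def add.commute)
  qed
  have bd: "(\<Sum>k<N j. norm (w k) powr p) \<le> (\<Sum>k<N 0. norm (A 0 k) powr p) + (\<Sum>i<j. (1/2) ^ i)" for j
  proof (induction j)
    case 0
    then show ?case using w[of _ 0] by simp
  next
    case (Suc j)
    have "(\<Sum>k<N (Suc j). norm (w k) powr p) = (\<Sum>k<N (Suc j). norm (A (Suc j) k) powr p)"
      using w[of _ "Suc j"] by simp
    also note S1
    also have "(\<Sum>k<N j. norm (A j k) powr p) = (\<Sum>k<N j. norm (w k) powr p)"
      using w[of _ j] by simp
    finally show ?case using Suc by simp
  qed
  have "summable (\<lambda>k. norm (w k) powr p)"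
  proof (rule bounded_imp_summable)
    show "(\<Sum>k\<le>n. norm (w k) powr p) \<le> (\<Sum>k<N 0. norm (A 0 k) powr p) + 2" for n
    proof -
      have "(\<Sum>k\<le>n. norm (w k) powr p) \<le> (\<Sum>k<N (Suc n). norm (w k) powr p)"
        using Nge[of "Suc n"] by (intro sum_mono2) auto
      also note bd
      also have "(\<Sum>i<Suc n. (1/2::real) ^ i) \<le> 2"
        using sum_le_suminf[OF summable_geometric[of "1/2::real"], of "{..<Suc n}"]
        by (simp add: suminf_geometric)
      finally show ?thesis by simp
    qed
  qed simp
  then have sF: "summable (\<lambda>k. norm (F w k) powr p)" by (rule mult)
  obtain j :: nat where j: "(\<Sum>k. norm (F w k) powr p) < real j" using reals_Archimedean2 by blast
  have "F w k = F (A (Suc j)) k" if "k < N (Suc j)" for k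
    unfolding F_def by (rule conv_cong_le) (use that w[of _ "Suc j"] in auto)
  then have "real j \<le> (\<Sum>k<N (Suc j). norm (F w k) powr p)" using F1[of j] by simp
  also have "\<dots> \<le> (\<Sum>k. norm (F w k) powr p)" by (intro sum_le_suminf sF) auto
  finally show False using j by simp
qed

section \<open>Taylor coefficients and multipliers of A_p\<close>

lemma taylor_eq:
  assumes "u has_fps_expansion F"
  shows "taylor u k = fps_nth F k"
  using fps_nth_fps_expansion[OF assms, of k] by (simp add: taylor_def)

lemma conv_radius_ge_of_summable:
  fixes a :: "nat \<Rightarrow> complex"
  assumes "\<And>z. z \<in> ball 0 R \<Longrightarrow> summable (\<lambda>k. a k * z ^ k)"
  shows "ereal R \<le> fps_conv_radius (Abs_fps a)"
  unfolding fps_conv_radius_def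
proof (rule conv_radius_geI_ex)
  fix r :: real assume "0 < r" "ereal r < ereal R"
  then show "\<exists>z. norm z = r \<and> summable (\<lambda>n. fps_nth (Abs_fps a) n * z ^ n)"
    using assms[of "of_real r"] by (intro exI[of _ "of_real r"]) auto
qed

lemma power_series_has_fps_expansion:
  fixes a :: "nat \<Rightarrow> complex"
  assumes "0 < R" "\<And>z. z \<in> ball 0 R \<Longrightarrow> summable (\<lambda>k. a k * z ^ k)"
  shows "eval_fps (Abs_fps a) has_fps_expansion Abs_fps a"
    and "eval_fps (Abs_fps a) holomorphic_on ball 0 R"
proof -
  have R: "ereal R \<le> fps_conv_radius (Abs_fps a)"
    using conv_radius_ge_of_summable assms(2) by blast
  then have "0 < fps_conv_radius (Abs_fps a)"
    using assms(1) by (metis ereal_less(2) order_less_le_trans)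
  then show "eval_fps (Abs_fps a) has_fps_expansion Abs_fps a"
    by (rule eval_fps_has_fps_expansion)
  show "eval_fps (Abs_fps a) holomorphic_on ball 0 R"
  proof (rule holomorphic_on_eval_fps)
    show "ball (0::complex) R \<subseteq> eball 0 (fps_conv_radius (Abs_fps a))"
    proof
      fix x :: complex assume "x \<in> ball 0 R"
      then have "ereal (norm x) < ereal R" by simp
      then show "x \<in> eball 0 (fps_conv_radius (Abs_fps a))"
        using less_le_trans[OF _ R] by (simp add: in_eball_iff)
    qed
  qed
qed

lemma symbol_eq: "symbol c = eval_fps (Abs_fps c)"
  by (simp add: symbol_def eval_fps_def fun_eq_iff)

text \<open>Weighted l^p coefficients are bounded after scaling by R^k, and comparison with a
  geometric series follows. Thus every such sequence comes from an analytic function on which the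
  definition of M_p can be tested.\<close>

lemma summable_powr_imp_power_series:
  fixes v :: "nat \<Rightarrow> complex"
  assumes "0 < p" "0 < R" "summable (\<lambda>k. norm (v k * of_real R ^ k) powr p)" "z \<in> ball 0 R"
  shows "summable (\<lambda>k. v k * z ^ k)"
proof -
  have "(\<lambda>k. norm (v k * of_real R ^ k) powr p) \<longlonglongrightarrow> 0"
    using assms(3) by (rule summable_LIMSEQ_zero)
  then have "(\<lambda>k. (norm (v k * of_real R ^ k) powr p) powr (1/p)) \<longlonglongrightarrow> 0"
    by (rule tendsto_zero_powrI[OF _ tendsto_const]) (use assms in auto)
  then have "(\<lambda>k. norm (v k * of_real R ^ k)) \<longlonglongrightarrow> 0"
    using assms(1) by (simp add: powr_powr)
  then have "Bseq (\<lambda>k. v k * of_real R ^ k)"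
    using convergent_imp_Bseq convergentI tendsto_norm_zero_iff by blast
  then obtain K where K: "\<And>k. norm (v k * of_real R ^ k) \<le> K" by (auto simp: Bseq_def)
  show ?thesis
  proof (rule summable_comparison_test')
    show "summable (\<lambda>k. K * (norm z / R) ^ k)"
      using assms by (intro summable_mult summable_geometric) auto
    show "norm (v k * z ^ k) \<le> K * (norm z / R) ^ k" for k
    proof -
      have "norm (v k * z ^ k) = norm (v k * of_real R ^ k) * (norm z / R) ^ k"
        using assms(2) by (simp add: norm_mult norm_power power_divide)
      then show ?thesis using K[of k] assms(2) by (simp add: mult_right_mono)
    qed
  qed
qed

text \<open>Multiplying the k-th coefficient by r^k is a ring homomorphism, so the weight can be
  absorbed into both factors.\<close>

lemma Abs_fps_rescale_mult:
  fixes r :: "'a::comm_ring_1"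
  shows "fps_nth (Abs_fps (\<lambda>k. a k * r ^ k) * Abs_fps (\<lambda>k. b k * r ^ k)) k
    = fps_nth (Abs_fps a * Abs_fps b) k * r ^ k"
proof -
  have "a i * r ^ i * (b (k - i) * r ^ (k - i)) = a i * b (k - i) * r ^ k" if "i \<le> k" for i
    using that power_add[of r i "k - i"] by (simp add: ac_simps)
  then show ?thesis by (simp add: fps_mult_nth sum_distrib_right)
qed

text \<open>Undo the weight on v, sum the resulting power series to an element of A_p, multiply by
  u, and read off the Taylor coefficients of the product as a Cauchy product.\<close>

lemma Mp_imp_multiplier:
  fixes v :: "nat \<Rightarrow> complex"
  assumes u: "u \<in> Mp p R" and p: "0 < p" and R: "0 < R"
    and v: "summable (\<lambda>k. norm (v k) powr p)"
  shows "summable (\<lambda>k. norm (fps_nth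
    (Abs_fps (\<lambda>k. taylor u k * of_real R ^ k) * Abs_fps v) k) powr p)"
proof -
  define b where "b k = v k / of_real R ^ k" for k
  have vb: "v = (\<lambda>k. b k * of_real R ^ k)" using R by (auto simp: b_def)
  have sb: "summable (\<lambda>k. norm (b k * of_real R ^ k) powr p)" using v unfolding vb .
  note ps = power_series_has_fps_expansion[OF R summable_powr_imp_power_series[OF p R sb]]
  have tb: "taylor (eval_fps (Abs_fps b)) k = b k" for k
    using taylor_eq[OF ps(1)] by simp
  have "eval_fps (Abs_fps b) \<in> Ap p R"
    using ps(2) sb by (simp add: Ap_def tb)
  then have uv: "(\<lambda>z. u z * eval_fps (Abs_fps b) z) \<in> Ap p R"
    using u by (simp add: Mp_def)
  have "u holomorphic_on ball 0 R" using u by (simp add: Mp_def Ap_def)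
  then have "u has_fps_expansion fps_expansion u 0"
    using R by (intro has_fps_expansion_fps_expansion[of "ball 0 R"]) auto
  moreover have "fps_expansion u 0 = Abs_fps (taylor u)"
    by (simp add: fps_expansion_def taylor_def [abs_def])
  ultimately have "(\<lambda>z. u z * eval_fps (Abs_fps b) z) has_fps_expansion Abs_fps (taylor u) * Abs_fps b"
    using ps(1) by (metis has_fps_expansion_mult)
  then have "taylor (\<lambda>z. u z * eval_fps (Abs_fps b) z) k = fps_nth (Abs_fps (taylor u) * Abs_fps b) k" for k
    by (rule taylor_eq)
  then show ?thesis
    using uv unfolding vb Abs_fps_rescale_mult by (simp add: Ap_def)
qed

lemma taylor_symbol:
  assumes "0 < R" "\<forall>z \<in> ball 0 R. summable (\<lambda>k. c k * z ^ k)"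
  shows "taylor (symbol c) = c"
  using taylor_eq[OF power_series_has_fps_expansion(1)[of R c]] assms
  by (auto simp: symbol_eq fun_eq_iff)

lemma symbol_mult_inverse:
  assumes R: "0 < R" and conv: "\<forall>z \<in> ball 0 R. summable (\<lambda>k. c k * z ^ k)"
    and nz: "\<forall>z \<in> ball 0 R. symbol c z \<noteq> 0"
  shows "Abs_fps c * Abs_fps (taylor (\<lambda>z. inverse (symbol c z))) = 1"
proof -
  note ps = power_series_has_fps_expansion[of R c, folded symbol_eq]
  have c: "symbol c has_fps_expansion Abs_fps c" "symbol c holomorphic_on ball 0 R"
    using ps R conv by auto
  have "(\<lambda>z. inverse (symbol c z)) holomorphic_on ball 0 R"
    using c(2) nz by (intro holomorphic_intros) auto
  then have "(\<lambda>z. inverse (symbol c z)) has_fps_expansion fps_expansion (\<lambda>z. inverse (symbol c z)) 0"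
    using R by (intro has_fps_expansion_fps_expansion[of "ball 0 R"]) auto
  moreover have "fps_expansion (\<lambda>z. inverse (symbol c z)) 0 = Abs_fps (taylor (\<lambda>z. inverse (symbol c z)))"
    by (simp add: fps_expansion_def taylor_def [abs_def])
  ultimately have "(\<lambda>z. symbol c z * inverse (symbol c z)) has_fps_expansion
      Abs_fps c * Abs_fps (taylor (\<lambda>z. inverse (symbol c z)))"
    using c(1) by (metis has_fps_expansion_mult)
  moreover have "eventually (\<lambda>z. symbol c z * inverse (symbol c z) = 1) (nhds 0)"
    using eventually_nhds_in_open[of "ball 0 R" "0::complex"] R nz
    by (auto elim!: eventually_mono)
  ultimately have "(\<lambda>z. 1) has_fps_expansion Abs_fps c * Abs_fps (taylor (\<lambda>z. inverse (symbol c z)))"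
    by (subst (asm) has_fps_expansion_cong[OF _ refl])
  then show ?thesis
    using has_fps_expansion_1 by (intro fps_expansion_unique_complex[of "\<lambda>_. 1"]) auto
qed

section \<open>Convolution in the norm weighted by interval lengths\<close>

definition wt :: "nat \<Rightarrow> real" where
  "wt n = (1/2) ^ lev n"

lemma wt_pos: "0 < wt n"
  by (simp add: wt_def)

text \<open>The inner sum runs over an initial segment of each chain, the shape to which a bound for
  finite sections applies. The cutoff N shortens different chains at different positions.\<close>

lemma sum_chains:
  fixes g :: "nat \<Rightarrow> real"
  shows "(\<Sum>n\<in>{0<..<N}. g n) = (\<Sum>q | odd q \<and> q < N. \<Sum>i<card {i. 2 ^ i * q < N}. g (2 ^ i * q))"
proof -
  \<comment> \<open>The set of admissible exponents is an initial segment, hence its cardinality is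
    its first missing element.\<close>
  have less: "i < card {i. 2 ^ i * q < N} \<longleftrightarrow> 2 ^ i * q < N" if "odd q" for i q :: nat
  proof -
    have q0: "0 < q" using that by (cases q) auto
    define m where "m = (LEAST i. N \<le> 2 ^ i * q)"
    have "N \<le> 2 ^ N * q" using q0 less_exp[of N] mult_le_mono[of N "2 ^ N" 1 q] by simp
    then have m: "N \<le> 2 ^ m * q" unfolding m_def by (rule LeastI)
    have "2 ^ i * q < N \<longleftrightarrow> i < m" for i
    proof
      assume "i < m" then show "2 ^ i * q < N" using not_less_Least unfolding m_def by (meson not_le)
    next
      assume *: "2 ^ i * q < N"
      show "i < m"
      proof (rule ccontr)
        assume "\<not> i < m"
        then have "2 ^ m * q \<le> 2 ^ i * q" by (intro mult_right_mono power_increasing) auto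
        then show False using m * by linarith
      qed
    qed
    then show ?thesis by (simp add: lessThan_def[symmetric])
  qed
  have "(\<Sum>q | odd q \<and> q < N. \<Sum>i<card {i. 2 ^ i * q < N}. g (2 ^ i * q))
      = (\<Sum>(q, i)\<in>Sigma {q. odd q \<and> q < N} (\<lambda>q. {i. 2 ^ i * q < N}). g (2 ^ i * q))"
  proof (subst sum.Sigma)
    have "{..<card {i. 2 ^ i * q < N}} = {i. 2 ^ i * q < N}" if "odd q" for q
      using less[OF that] by auto
    then have "Sigma {q. odd q \<and> q < N} (\<lambda>q. {..<card {i. 2 ^ i * q < N}})
        = Sigma {q. odd q \<and> q < N} (\<lambda>q. {i. 2 ^ i * q < N})" by auto
    then show "(\<Sum>(x, y)\<in>Sigma {q. odd q \<and> q < N} (\<lambda>q. {..<card {i. 2 ^ i * q < N}}). g (2 ^ y * x))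
       = (\<Sum>(q, i)\<in>Sigma {q. odd q \<and> q < N} (\<lambda>q. {i. 2 ^ i * q < N}). g (2 ^ i * q))" by simp
  qed auto
  also have "\<dots> = (\<Sum>n\<in>{0<..<N}. g n)"
  proof (rule sum.reindex_bij_witness[of _
        "\<lambda>n. (n div 2 ^ multiplicity 2 n, multiplicity 2 n)" "\<lambda>(q, i). 2 ^ i * q"], goal_cases)
    case (1 x) then show ?case by (auto simp: multiplicity_pow_mult_odd)
  next
    case (2 x) then show ?case by (auto simp: odd_pos)
  next
    case (3 n)
    then show ?case by (simp add: multiplicity_dvd)
  next
    case (4 n)
    then have "0 < n" "n < N" by auto
    obtain i q where q: "odd q" "n = 2 ^ i * q" using pow_mult_odd_cases[OF \<open>0 < n\<close>] .
    have "q \<le> 2 ^ i * q" by simp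
    then have "q < N" using \<open>n < N\<close> unfolding q(2) by (rule le_less_trans)
    then show ?case using q \<open>n < N\<close> by (simp add: multiplicity_pow_mult_odd)
  next
    case (5 x) then show ?case by auto
  qed
  finally show ?thesis by simp
qed

text \<open>On the chain of q the weight is \<open>wt q\<close> times R^(ip). The factor
  \<open>wt q\<close> comes out, the rest is the unweighted multiplier bound, and its constant is
  the same for all chains.\<close>

lemma chain_conv_bounded:
  fixes c :: "nat \<Rightarrow> complex"
  assumes u: "u \<in> Mp p (2 powr (-1/p))" and p: "0 < p"
  shows "\<exists>C\<ge>0. \<forall>a N. (\<Sum>n\<in>{0<..<N}. norm (chain_conv (taylor u) a n) powr p * wt n)
    \<le> C * (\<Sum>n\<in>{0<..<N}. norm (a n) powr p * wt n)"
proof -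
  define R where "R = 2 powr (-1/p)"
  have R: "0 < R" by (simp add: R_def)
  have Rp: "norm (z * of_real R ^ i) powr p = norm z powr p * (1/2) ^ i" for z :: complex and i
  proof -
    have "(R ^ i) powr p = (R powr p) ^ i"
      by (induction i) (use R in \<open>simp_all add: powr_mult\<close>)
    also have "R powr p = 1/2" using p by (simp only: R_def powr_powr) (simp add: powr_minus_divide)
    finally show ?thesis using R by (simp add: norm_mult norm_power powr_mult)
  qed
  obtain C where C: "0 \<le> C" "\<And>v n.
      (\<Sum>k<n. norm (fps_nth (Abs_fps (\<lambda>k. taylor u k * of_real R ^ k) * Abs_fps v) k) powr p)
      \<le> C * (\<Sum>k<n. norm (v k) powr p)"
    using multiplier_bounded[OF p Mp_imp_multiplier[OF u p R[unfolded R_def]]]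
    unfolding R_def by blast
  have "(\<Sum>n\<in>{0<..<N}. norm (chain_conv (taylor u) a n) powr p * wt n)
    \<le> C * (\<Sum>n\<in>{0<..<N}. norm (a n) powr p * wt n)" for a N
    unfolding sum_chains sum_distrib_left
  proof (rule sum_mono)
    fix q assume "q \<in> {q. odd q \<and> q < N}"
    then have q: "odd q" "0 < q" by (auto simp: odd_pos)
    define n where "n = card {i. 2 ^ i * q < N}"
    have wt: "wt (2 ^ i * q) = wt q * (1/2) ^ i" for i
      using q(2) by (simp add: wt_def lev_pow_mult power_add)
    have "(\<Sum>i<n. norm (chain_conv (taylor u) a (2 ^ i * q)) powr p * wt (2 ^ i * q))
        = wt q * (\<Sum>i<n. norm (fps_nth (Abs_fps (\<lambda>k. taylor u k * of_real R ^ k)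
            * Abs_fps (\<lambda>k. a (2 ^ k * q) * of_real R ^ k)) i) powr p)"
      unfolding Abs_fps_rescale_mult Rp wt chain_conv_pow_mult[OF q(1)] sum_distrib_left
      by (simp add: ac_simps)
    also have "\<dots> \<le> wt q * (C * (\<Sum>i<n. norm (a (2 ^ i * q) * of_real R ^ i) powr p))"
      by (intro mult_left_mono C) (simp add: wt_def)
    also have "\<dots> = (\<Sum>i<n. C * (norm (a (2 ^ i * q)) powr p * wt (2 ^ i * q)))"
      unfolding Rp wt by (simp add: sum_distrib_left ac_simps)
    finally show "(\<Sum>i<card {i. 2 ^ i * q < N}. norm (chain_conv (taylor u) a (2 ^ i * q)) powr p * wt (2 ^ i * q))
      \<le> (\<Sum>i<card {i. 2 ^ i * q < N}. C * (norm (a (2 ^ i * q)) powr p * wt (2 ^ i * q)))"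
      unfolding n_def .
  qed
  then show ?thesis using C(1) by blast
qed

subsection \<open>\<open>L\<^sup>p\<close> bounds for Haar sums\<close>

lemma exists_powr_eq:
  fixes M p :: real
  assumes "1 < M" "0 < p"
  obtains e where "0 < e" "(1 + e) powr p = M"
proof
  show "0 < M powr (1/p) - 1" using assms by (simp add: gr_one_powr)
  show "(1 + (M powr (1/p) - 1)) powr p = M" using assms by (simp add: powr_powr)
qed

lemma wt_double: "0 < n \<Longrightarrow> wt (2 * n) = wt n / 2"
  and wt_Suc_double: "0 < n \<Longrightarrow> wt (Suc (2 * n)) = wt n / 2"
  by (simp_all add: wt_def lev_double lev_Suc_double)

text \<open>Finite truncations let a multiple of a sum be absorbed into the left-hand side without
  knowing beforehand that the full sum converges.\<close>

definition Nset_below :: "nat \<Rightarrow> nat \<Rightarrow> nat set" where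
  "Nset_below d N = {n \<in> N_set d. n < N}"

lemma finite_Nset_below [simp]: "finite (Nset_below d N)"
  by (simp add: Nset_below_def)

lemma Nset_below_pos: "n \<in> Nset_below d N \<Longrightarrow> 0 < n"
  by (simp add: Nset_below_def N_set_iff)

lemma Nset_below_double_D: "2 * m \<in> Nset_below d N \<Longrightarrow> m \<in> Nset_below d N"
  by (auto simp: Nset_below_def N_set_iff ones_double)

text \<open>Passing from m to 2 m adds one term to the chain sum and halves the weight. The halving
  beats the loss in the weighted power inequality, so the sum reproduces itself with a factor below
  1 and can be absorbed.\<close>

lemma chain_sum_bounded:
  assumes p: "0 < p"
  obtains C where "0 \<le> C" "\<And>a d N. (\<Sum>n\<in>Nset_below d N. norm (chain_sum a n) powr p * wt n)
    \<le> C * (\<Sum>n\<in>Nset_below d N. norm (a n) powr p * wt n)"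
proof -
  \<comment> \<open>Any value strictly between 1 and 2 would do: half of 3/2 is 3/4, and absorbing
    3/4 turns K/2 into 2 K.\<close>
  obtain e :: real where e: "0 < e" "(1 + e) powr p = 3/2"
    using exists_powr_eq[of "3/2" p] p by auto
  define K where "K = (1 + 1/e) powr p"
  have "(\<Sum>n\<in>Nset_below d N. norm (chain_sum a n) powr p * wt n)
    \<le> (2 * K) * (\<Sum>n\<in>Nset_below d N. norm (a n) powr p * wt n)" for a d N
  proof -
    let ?F = "Nset_below d N"
    define V where "V n = norm (chain_sum a n) powr p * wt n" for n
    have V0: "0 \<le> V n" for n using wt_pos[of n] by (simp add: V_def)
    let ?E = "{m \<in> ?F. 2 * m \<in> ?F}"
    have Vd: "V (2 * m) \<le> 3/4 * V m + K/2 * (norm (a m) powr p * wt m)" if "0 < m" for m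
    proof -
      have "norm (chain_sum a m + a m) powr p * (wt m / 2)
          \<le> (3/2 * norm (chain_sum a m) powr p + K * norm (a m) powr p) * (wt m / 2)"
        using norm_add_powr_le_weighted[OF e(1) p, of "chain_sum a m" "a m"] wt_pos[of m]
        by (intro mult_right_mono) (auto simp: e K_def)
      then show ?thesis
        unfolding V_def chain_sum_double[OF that] wt_double[OF that] by (simp add: algebra_simps)
    qed
    \<comment> \<open>Odd nodes start their chain and have chain sum 0, and the truncated set is
      closed under halving.\<close>
    have "(\<Sum>n\<in>?F. V n) = (\<Sum>n\<in>(\<lambda>m. 2 * m) ` ?E. V n)"
    proof (rule sum.mono_neutral_right)
      show "\<forall>n\<in>?F - (\<lambda>m. 2 * m) ` ?E. V n = 0"
      proof
        fix n assume n: "n \<in> ?F - (\<lambda>m. 2 * m) ` ?E"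
        have "odd n"
        proof
          assume "even n"
          then obtain m where m: "n = 2 * m" by (elim evenE)
          then have "m \<in> ?E" using n Nset_below_double_D by auto
          then show False using n m by auto
        qed
        then show "V n = 0" using p by (simp add: V_def chain_sum_odd)
      qed
    qed auto
    also have "\<dots> = (\<Sum>m\<in>?E. V (2 * m))"
      by (simp add: sum.reindex inj_on_def)
    also have "\<dots> \<le> (\<Sum>m\<in>?E. 3/4 * V m + K/2 * (norm (a m) powr p * wt m))"
      using Nset_below_pos by (intro sum_mono Vd) auto
    also have "\<dots> \<le> (\<Sum>m\<in>?F. 3/4 * V m + K/2 * (norm (a m) powr p * wt m))"
      using V0 wt_pos by (intro sum_mono2) (auto simp: K_def less_imp_le)
    also have "\<dots> = 3/4 * (\<Sum>m\<in>?F. V m) + K/2 * (\<Sum>m\<in>?F. norm (a m) powr p * wt m)"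
      by (simp add: sum.distrib sum_distrib_left)
    finally show ?thesis by (simp add: V_def)
  qed
  moreover have "0 \<le> 2 * K" by (simp add: K_def)
  ultimately show thesis using that by blast
qed

lemma sets_dyad [measurable]: "dyad n \<inter> {0<..1} \<in> sets I01" "0 < n \<Longrightarrow> dyad n \<in> sets I01"
proof -
  have "dyad n \<in> sets lebesgue" by (simp add: dyad_def)
  then show "dyad n \<inter> {0<..1} \<in> sets I01" by (auto simp: sets_restrict_space)
  then show "0 < n \<Longrightarrow> dyad n \<in> sets I01" using dyad_subset[of n] by (simp add: Int_absorb2)
qed

lemma emeasure_dyad: "0 < n \<Longrightarrow> emeasure I01 (dyad n) = ennreal (wt n)"
proof -
  assume n: "0 < n"
  have "emeasure I01 (dyad n) = emeasure lebesgue (dyad n)"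
    using dyad_subset[OF n] by (intro emeasure_restrict_space) auto
  also have "\<dots> = ennreal ((real (pos n) + 1) / 2 ^ lev n - real (pos n) / 2 ^ lev n)"
    unfolding dyad_def by (subst emeasure_lborel_Ioc[symmetric]) (auto simp: divide_right_mono)
  also have "(real (pos n) + 1) / 2 ^ lev n - real (pos n) / 2 ^ lev n = wt n"
    by (simp add: wt_def power_one_over diff_divide_distrib[symmetric])
  finally show ?thesis .
qed

lemma haar_n_indicator:
  "0 < n \<Longrightarrow> haar_n n t = indicator (dyad (2 * n)) t - indicator (dyad (Suc (2 * n))) t"
  using dyad_Un[of n] dyad_Int[of n] by (auto simp: haar_n_eq indicator_def)

lemma borel_measurable_haar_n [measurable]:
  assumes "0 < n"
  shows "haar_n n \<in> borel_measurable I01"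
proof -
  have "haar_n n = (\<lambda>t. indicator (dyad (2 * n)) t - indicator (dyad (Suc (2 * n))) t)"
    using haar_n_indicator[OF assms] by (rule ext)
  then show ?thesis using assms
    by (simp only:) (intro borel_measurable_diff borel_measurable_indicator sets_dyad, auto)
qed

text \<open>The index set varies with t, so measurability is obtained from fixed finite sums that
  are eventually constant at each point.\<close>

lemma borel_measurable_haar_sum:
  assumes "1 \<le> d"
  shows "haar_sum d a \<in> borel_measurable I01"
proof (rule borel_measurable_LIMSEQ_metric)
  show "(\<lambda>t. \<Sum>m\<in>Nset_below d N. a m * haar_n m t) \<in> borel_measurable I01" for N
    by (intro borel_measurable_sum borel_measurable_times borel_measurable_haar_n)
      (auto dest: Nset_below_pos)
  fix t assume "t \<in> space I01"
  then have t: "t \<in> {0<..1}" by simp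
  obtain q k where "path_data d q k t" using path_data_exists[OF t assms] .
  then have fin: "finite {m \<in> N_set d. t \<in> dyad m}" by (simp add: path_data_def)
  then obtain M where M: "\<And>m. m \<in> {m \<in> N_set d. t \<in> dyad m} \<Longrightarrow> m < M"
    by (metis finite_nat_set_iff_bounded)
  have "(\<Sum>m\<in>Nset_below d N. a m * haar_n m t) = haar_sum d a t" if "M \<le> N" for N
    unfolding haar_sum_def
  proof (rule sum.mono_neutral_right)
    show "{m \<in> N_set d. t \<in> dyad m} \<subseteq> Nset_below d N"
      using M that by (fastforce simp: Nset_below_def)
    show "\<forall>i\<in>Nset_below d N - {m \<in> N_set d. t \<in> dyad m}. a i * haar_n i t = 0"
      using dyad_double_subset by (auto simp: Nset_below_def haar_n_eq N_set_iff)
  qed simp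
  then show "(\<lambda>N. \<Sum>m\<in>Nset_below d N. a m * haar_n m t) \<longlonglongrightarrow> haar_sum d a t"
    by (intro tendsto_eventually) (auto simp: eventually_sequentially)
qed

lemma Lp_of_nn_integral:
  assumes "f \<in> borel_measurable I01" "0 \<le> K"
    and "(\<integral>\<^sup>+t. ennreal (norm (f t) powr p) \<partial>I01) \<le> ennreal K"
  shows "Lp p f" "integral\<^sup>L I01 (\<lambda>t. norm (f t) powr p) \<le> K"
proof -
  have m: "(\<lambda>t. norm (f t) powr p) \<in> borel_measurable I01" using assms(1) by measurable
  have "integrable I01 (\<lambda>t. norm (f t) powr p)"
    using m assms(3) by (intro integrableI_nonneg) (auto intro: le_less_trans)
  then show "Lp p f" using assms(1) by (simp add: Lp_def)
  show "integral\<^sup>L I01 (\<lambda>t. norm (f t) powr p) \<le> K"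
    using m assms(2,3) by (subst integral_eq_nn_integral) (auto intro: enn2real_leI)
qed

lemma haar_sum_bounded:
  assumes p: "0 < p"
  obtains C where "0 \<le> C" "\<And>d a K. 1 \<le> d \<Longrightarrow>
    (\<And>N. (\<Sum>n\<in>Nset_below d N. norm (a n) powr p * wt n) \<le> K) \<Longrightarrow>
    Lp p (haar_sum d a) \<and> integral\<^sup>L I01 (\<lambda>t. norm (haar_sum d a t) powr p) \<le> C * K"
proof -
  obtain C where C: "0 \<le> C" "\<And>a d N. (\<Sum>n\<in>Nset_below d N. norm (chain_sum a n) powr p * wt n)
    \<le> C * (\<Sum>n\<in>Nset_below d N. norm (a n) powr p * wt n)"
    using chain_sum_bounded[OF p] by blast
  define C' where "C' = 2 powr p * (C + 1)"
  have C'0: "0 \<le> C'" using C(1) by (simp add: C'_def)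
  have "Lp p (haar_sum d a) \<and> integral\<^sup>L I01 (\<lambda>t. norm (haar_sum d a t) powr p) \<le> C' * K"
    if d: "1 \<le> d" and K: "\<And>N. (\<Sum>n\<in>Nset_below d N. norm (a n) powr p * wt n) \<le> K" for d a K
  proof -
    have K0: "0 \<le> K" using K[of 0] by (simp add: Nset_below_def)
    define b where "b n = (if n \<in> N_set d then norm (chain_sum a n - a n) powr p else 0)" for n
    \<comment> \<open>The right half of \<open>dyad n\<close> is where n is the last node of
      \<open>N_set d\<close> met, and there the Haar sum has p-th power of modulus
      \<open>b n\<close>.\<close>
    define g where "g n t = ennreal (b n) * indicator (dyad (Suc (2 * n))) t" for n t
    have "(\<integral>\<^sup>+t. ennreal (norm (haar_sum d a t) powr p) \<partial>I01) \<le> (\<integral>\<^sup>+t. (\<Sum>n. g n t) \<partial>I01)"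
    proof (rule nn_integral_mono)
      fix t assume "t \<in> space I01"
      then have t: "t \<in> {0<..1}" by simp
      obtain q k where "path_data d q k t" using path_data_exists[OF t d] .
      then interpret path_data d q k t .
      have "2 ^ k * q \<in> N_set d" using q_N by (simp add: N_set_iff ones_pow_mult)
      then have "ennreal (norm (haar_sum d a t) powr p) = g (2 ^ k * q) t"
        using turn by (simp add: g_def b_def haar_sum_chain_sum)
      also have "\<dots> \<le> (\<Sum>n. g n t)"
        using sum_le_suminf[OF summableI, of "{2 ^ k * q}" "\<lambda>n. g n t"] by simp
      finally show "ennreal (norm (haar_sum d a t) powr p) \<le> (\<Sum>n. g n t)" .
    qed
    also have "\<dots> = (\<Sum>n. \<integral>\<^sup>+t. g n t \<partial>I01)"
      unfolding g_def by (intro nn_integral_suminf) measurable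
    also have "\<dots> \<le> (\<Sum>n. ennreal (b n * wt n))"
    proof (intro suminf_le summableI)
      fix n
      have "(\<integral>\<^sup>+t. g n t \<partial>I01) = ennreal (b n) * ennreal (wt (Suc (2 * n)))"
        unfolding g_def by (subst nn_integral_cmult_indicator) (auto simp: emeasure_dyad)
      also have "\<dots> = ennreal (b n * wt (Suc (2 * n)))"
        using wt_pos by (intro ennreal_mult[symmetric]) (auto simp: b_def less_imp_le)
      also have "b n * wt (Suc (2 * n)) \<le> b n * wt n"
      proof (cases "n = 0")
        case False
        then have "wt (Suc (2 * n)) \<le> wt n" using wt_pos[of n] by (simp add: wt_Suc_double)
        then show ?thesis by (intro mult_left_mono) (auto simp: b_def)
      qed (simp add: b_def N_set_iff)
      finally show "(\<integral>\<^sup>+t. g n t \<partial>I01) \<le> ennreal (b n * wt n)" by (simp add: ennreal_leI)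
    qed
    also have "\<dots> \<le> ennreal (C' * K)"
    proof (rule suminf_le_const)
      fix N
      have "(\<Sum>n<N. ennreal (b n * wt n)) = ennreal (\<Sum>n<N. b n * wt n)"
        using wt_pos by (intro sum_ennreal) (auto simp: b_def less_imp_le)
      also have "(\<Sum>n<N. b n * wt n) = (\<Sum>n\<in>Nset_below d N. norm (chain_sum a n - a n) powr p * wt n)"
        by (rule sum.mono_neutral_cong_right) (auto simp: b_def Nset_below_def)
      also have "\<dots> \<le> (\<Sum>n\<in>Nset_below d N. 2 powr p * (norm (chain_sum a n) powr p + norm (a n) powr p) * wt n)"
        using wt_pos by (intro sum_mono mult_right_mono norm_diff_powr_le p) (auto simp: less_imp_le)
      also have "\<dots> = 2 powr p * ((\<Sum>n\<in>Nset_below d N. norm (chain_sum a n) powr p * wt n)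
          + (\<Sum>n\<in>Nset_below d N. norm (a n) powr p * wt n))"
        by (simp add: sum_distrib_left sum.distrib algebra_simps)
      also have "\<dots> \<le> 2 powr p * (C * K + K)"
        using C(2)[of a d N] mult_left_mono[OF K[of N] C(1)] K[of N]
        by (intro mult_left_mono add_mono) auto
      finally show "(\<Sum>n<N. ennreal (b n * wt n)) \<le> ennreal (C' * K)"
        by (simp add: C'_def algebra_simps ennreal_leI)
    qed simp
    finally show ?thesis
      using Lp_of_nn_integral[OF borel_measurable_haar_sum[OF d] mult_nonneg_nonneg[OF C'0 K0]] by blast
  qed
  then show thesis using that C'0 by blast
qed

subsection \<open>Dyadic averages\<close>

definition avg :: "(real \<Rightarrow> complex) \<Rightarrow> nat \<Rightarrow> complex" where
  "avg x n = 2 ^ lev n * (LINT t:dyad n|I01. x t)"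

text \<open>The integral of h_n^2 is 2^-m with m = \<open>lev n\<close>, so this is the coefficient
  of h_n in the Haar expansion.\<close>

definition coef :: "(real \<Rightarrow> complex) \<Rightarrow> nat \<Rightarrow> complex" where
  "coef x n = 2 ^ lev n * pair x (haar_n n)"

definition dyad_energy :: "real \<Rightarrow> (real \<Rightarrow> complex) \<Rightarrow> nat \<Rightarrow> real" where
  "dyad_energy p x n = (LINT t:dyad n|I01. norm (x t) powr p)"

lemma finite_measure_I01: "finite_measure I01"
  by (rule finite_measureI) (simp add: emeasure_restrict_space)

lemma integrable_const_I01 [simp]: "integrable I01 (\<lambda>t. k :: 'a::{banach, second_countable_topology})"
  using finite_measure.integrable_const[OF finite_measure_I01] .

lemma Lp_imp_integrable:
  assumes "1 \<le> p" "Lp p x"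
  shows "integrable I01 x"
proof (rule Bochner_Integration.integrable_bound)
  show "integrable I01 (\<lambda>t. 1 + norm (x t) powr p)"
    using assms(2) by (simp add: Lp_def)
  show "x \<in> borel_measurable I01" using assms(2) by (simp add: Lp_def)
  have "norm (x t) \<le> 1 + norm (x t) powr p" for t
  proof (cases "norm (x t) \<le> 1")
    case True then show ?thesis by (simp add: add_increasing2)
  next
    case False
    then have "norm (x t) powr 1 \<le> norm (x t) powr p" using assms(1) by (intro powr_mono) auto
    then show ?thesis using False by simp
  qed
  then show "AE t in I01. norm (x t) \<le> norm (1 + norm (x t) powr p)" by simp
qed

lemma set_integrable_dyad:
  fixes x :: "real \<Rightarrow> 'a::{banach, second_countable_topology}"
  shows "0 < n \<Longrightarrow> integrable I01 x \<Longrightarrow> set_integrable I01 (dyad n) x"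
  unfolding set_integrable_def by (intro integrable_mult_indicator sets_dyad)

lemma set_integral_dyad_split:
  fixes x :: "real \<Rightarrow> 'a::{banach, second_countable_topology}"
  assumes "0 < n" "integrable I01 x"
  shows "(LINT t:dyad n|I01. x t) = (LINT t:dyad (2 * n)|I01. x t) + (LINT t:dyad (Suc (2 * n))|I01. x t)"
  unfolding dyad_Un[OF assms(1), symmetric]
  by (rule set_integral_Un) (use assms in \<open>auto intro!: set_integrable_dyad dyad_Int\<close>)

lemma pair_haar_n:
  assumes "0 < n" "integrable I01 x"
  shows "pair x (haar_n n) = (LINT t:dyad (2 * n)|I01. x t) - (LINT t:dyad (Suc (2 * n))|I01. x t)"
    and "integrable I01 (\<lambda>t. x t * haar_n n t)"
proof -
  have eq: "x t * haar_n n t = indicator (dyad (2 * n)) t *\<^sub>R x t - indicator (dyad (Suc (2 * n))) t *\<^sub>R x t" for t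
    using haar_n_indicator[OF assms(1), of t] by (auto simp: indicator_def)
  have i: "set_integrable I01 (dyad (2 * n)) x" "set_integrable I01 (dyad (Suc (2 * n))) x"
    using assms by (auto intro!: set_integrable_dyad)
  then show "pair x (haar_n n) = (LINT t:dyad (2 * n)|I01. x t) - (LINT t:dyad (Suc (2 * n))|I01. x t)"
    unfolding pair_def eq set_lebesgue_integral_def set_integrable_def
    by (rule Bochner_Integration.integral_diff)
  show "integrable I01 (\<lambda>t. x t * haar_n n t)"
    using i unfolding eq set_integrable_def by (rule Bochner_Integration.integrable_diff)
qed

lemma avg_double:
  assumes "0 < n" "integrable I01 x"
  shows "avg x (2 * n) = avg x n + coef x n"
    and "avg x (Suc (2 * n)) = avg x n - coef x n"
  unfolding avg_def coef_def pair_haar_n(1)[OF assms] set_integral_dyad_split[OF assms]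
      lev_double[OF assms(1)] lev_Suc_double[OF assms(1)]
  by (simp_all add: algebra_simps)

lemma avg_one: "avg x 1 = integral\<^sup>L I01 x"
proof -
  have "(LINT t:dyad 1|I01. x t) = integral\<^sup>L I01 x"
    unfolding set_lebesgue_integral_def
    by (rule Bochner_Integration.integral_cong) (auto simp: dyad_one)
  then show ?thesis by (simp add: avg_def)
qed

text \<open>The factor 2^(m-j) in g^n is the normalization of the Haar coefficient at n / 2^j, a
  node of level m - j.\<close>

lemma pair_gfun:
  assumes n: "0 < n" and x: "integrable I01 x"
  shows "pair x (gfun d n) = chain_conv d (coef x) n"
proof -
  obtain i q where q: "odd q" "n = 2 ^ i * q" using pow_mult_odd_cases[OF n] .
  have q0: "0 < q" using q(1) by (rule odd_pos)
  have m: "multiplicity 2 n = i" using q by (simp add: multiplicity_pow_mult_odd)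
  have node: "0 < n div 2 ^ j \<and> lev n - j = lev (n div 2 ^ j)" if "j \<in> {0..i}" for j
    using that q0 by (simp add: q(2) pow_mult_div lev_pow_mult)
  have "pair x (gfun d n) = (LINT t|I01. (\<Sum>j=0..i. d j * 2 ^ (lev n - j) * (x t * haar_n (n div 2 ^ j) t)))"
    by (simp add: pair_def gfun_def m sum_distrib_left mult.left_commute)
  also have "\<dots> = (\<Sum>j=0..i. LINT t|I01. d j * 2 ^ (lev n - j) * (x t * haar_n (n div 2 ^ j) t))"
    using node by (intro Bochner_Integration.integral_sum integrable_mult_right pair_haar_n(2)[OF _ x]) auto
  also have "\<dots> = (\<Sum>j=0..i. d j * coef x (n div 2 ^ j))"
    using node by (intro sum.cong) (auto simp: coef_def pair_def mult.assoc)
  finally show ?thesis by (simp add: chain_conv_def m)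
qed

section \<open>Jensen's inequality and the energy of Haar coefficients\<close>

text \<open>The convex function s^p lies above its tangent at a. This is Young's inequality for s
  and a^(p-1) with conjugate exponent p / (p - 1).\<close>

lemma powr_tangent_le:
  fixes s a p :: real
  assumes "1 < p" "0 \<le> s" "0 \<le> a"
  shows "a powr p + p * a powr (p - 1) * (s - a) \<le> s powr p"
proof -
  define q where "q = p / (p - 1)"
  have q: "1 < q" "1 / p + 1 / q = 1" using assms(1) by (auto simp: q_def field_simps)
  have "s * a powr (p - 1) \<le> s powr p / p + (a powr (p - 1)) powr q / q"
    using assms q by (intro Youngs_inequality) auto
  also have "(a powr (p - 1)) powr q = a powr p" using assms(1) by (simp add: powr_powr q_def)
  finally have "p * (s * a powr (p - 1)) \<le> p * (s powr p / p + a powr p / q)"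
    using assms(1) by (intro mult_left_mono) auto
  also have "\<dots> = s powr p + (p - 1) * a powr p" using assms(1) by (simp add: q_def field_simps)
  finally have "p * (s * a powr (p - 1)) \<le> s powr p + (p - 1) * a powr p" .
  moreover have "a powr (p - 1) * a = a powr p"
    using assms by (cases "a = 0") (auto simp: powr_diff)
  ultimately show ?thesis by (simp add: algebra_simps)
qed

lemma norm_avg_le:
  assumes n: "0 < n" and x: "integrable I01 x"
  shows "norm (avg x n) * wt n \<le> (LINT t:dyad n|I01. norm (x t))"
proof -
  have "norm (avg x n) * wt n = norm (LINT t:dyad n|I01. x t)"
    by (simp add: avg_def wt_def norm_mult norm_power power_one_over)
  also have "\<dots> \<le> (LINT t:dyad n|I01. norm (x t))"
    by (rule set_integral_norm_bound) (rule set_integrable_dyad[OF n x])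
  finally show ?thesis .
qed

lemma set_integral_dyad_const:
  "0 < n \<Longrightarrow> (LINT t:dyad n|I01. k) = k * (wt n :: real)"
proof -
  assume n: "0 < n"
  have "measure I01 (dyad n) = wt n"
    using emeasure_dyad[OF n] wt_pos[of n] by (simp add: measure_def less_imp_le)
  then show ?thesis
    using n by (subst set_integral_const) (auto simp: sets_dyad emeasure_dyad)
qed

text \<open>Jensen's inequality: integrate the tangent inequality at the modulus of the average over
  \<open>dyad n\<close>; the slope b is nonnegative, so replacing the integral of |x| by its lower
  bound is legitimate.\<close>

lemma avg_powr_le:
  assumes p: "1 < p" and x: "Lp p x" and n: "0 < n"
  shows "norm (avg x n) powr p * wt n \<le> dyad_energy p x n"
proof -
  have xi: "integrable I01 x" using Lp_imp_integrable[OF _ x] p by simp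
  define a where "a = norm (avg x n)"
  define b where "b = p * a powr (p - 1)"
  have b0: "0 \<le> b" using p by (simp add: b_def)
  have i1: "set_integrable I01 (dyad n) (\<lambda>t. norm (x t))"
    using xi by (intro set_integrable_dyad n integrable_norm)
  have i2: "set_integrable I01 (dyad n) (\<lambda>t. a powr p - b * a + b * norm (x t))"
    using xi by (intro set_integrable_dyad n) auto
  have i3: "set_integrable I01 (dyad n) (\<lambda>t. norm (x t) powr p)"
    using x by (intro set_integrable_dyad n) (simp add: Lp_def)
  have "a powr p * wt n \<le> (a powr p - b * a) * wt n + b * (LINT t:dyad n|I01. norm (x t))"
    using mult_left_mono[OF norm_avg_le[OF n xi] b0] by (simp add: a_def algebra_simps)
  also have "\<dots> = (LINT t:dyad n|I01. a powr p - b * a) + (LINT t:dyad n|I01. b * norm (x t))"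
    by (simp only: set_integral_dyad_const[OF n] set_integral_mult_right)
  also have "\<dots> = (LINT t:dyad n|I01. a powr p - b * a + b * norm (x t))"
    by (rule set_integral_add(2)[symmetric]) (use xi n in \<open>auto intro!: set_integrable_dyad\<close>)
  also have "\<dots> \<le> dyad_energy p x n"
    unfolding dyad_energy_def
  proof (rule set_integral_mono[OF i2 i3])
    fix t
    show "a powr p - b * a + b * norm (x t) \<le> norm (x t) powr p"
      using powr_tangent_le[OF p, of "norm (x t)" a] by (simp add: a_def b_def algebra_simps)
  qed
  finally show ?thesis by (simp add: a_def)
qed

lemma sum_dyad_energy_le:
  assumes x: "Lp p x" and G: "finite G" "0 \<notin> G"
    and disj: "\<And>t m n. m \<in> G \<Longrightarrow> n \<in> G \<Longrightarrow> t \<in> dyad m \<Longrightarrow> t \<in> dyad n \<Longrightarrow> m = n"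
  shows "(\<Sum>n\<in>G. dyad_energy p x n) \<le> integral\<^sup>L I01 (\<lambda>t. norm (x t) powr p)"
proof -
  have i: "integrable I01 (\<lambda>t. norm (x t) powr p)" using x by (simp add: Lp_def)
  have si: "integrable I01 (\<lambda>t. indicator (dyad n) t *\<^sub>R norm (x t) powr p)" if "n \<in> G" for n
    using set_integrable_dyad[OF _ i, of n] G that by (cases n) (auto simp: set_integrable_def)
  have "(\<Sum>n\<in>G. dyad_energy p x n) = (LINT t|I01. (\<Sum>n\<in>G. indicator (dyad n) t *\<^sub>R norm (x t) powr p))"
    unfolding dyad_energy_def set_lebesgue_integral_def
    by (rule Bochner_Integration.integral_sum[symmetric]) (rule si)
  also have "\<dots> \<le> integral\<^sup>L I01 (\<lambda>t. norm (x t) powr p)"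
  proof (rule integral_mono)
    show "integrable I01 (\<lambda>t. \<Sum>n\<in>G. indicator (dyad n) t *\<^sub>R norm (x t) powr p)"
      using si by (rule Bochner_Integration.integrable_sum)
    show "integrable I01 (\<lambda>t. norm (x t) powr p)" by (rule i)
    fix t
    show "(\<Sum>n\<in>G. indicator (dyad n) t *\<^sub>R norm (x t) powr p) \<le> norm (x t) powr p"
    proof (cases "\<exists>m\<in>G. t \<in> dyad m")
      case True
      then obtain m where m: "m \<in> G" "t \<in> dyad m" by blast
      have "(\<Sum>n\<in>G. indicator (dyad n) t *\<^sub>R norm (x t) powr p)
          = (\<Sum>n\<in>{m}. indicator (dyad n) t *\<^sub>R norm (x t) powr p)"
        by (rule sum.mono_neutral_right) (use G m disj in \<open>auto simp: indicator_def\<close>)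
      then show ?thesis using m by simp
    next
      case False
      then have "(\<Sum>n\<in>G. indicator (dyad n) t *\<^sub>R norm (x t) powr p) = 0"
        by (intro sum.neutral) (auto simp: indicator_def)
      then show ?thesis by simp
    qed
  qed
  finally show ?thesis .
qed


text \<open>A Hardy inequality: the average over \<open>dyad n\<close> is the mean of the averages over the halves.
  Its left half is the next node of the chain, and enters with a factor below 1 since
  \<open>p > 1\<close>; the right halves are pairwise disjoint.\<close>

lemma sum_coef_powr_bounded:
  assumes p: "1 < p"
  obtains C where "0 \<le> C" "\<And>d x N. Lp p x \<Longrightarrow>
    (\<Sum>n\<in>Nset_below d N. norm (coef x n) powr p * wt n) \<le> C * integral\<^sup>L I01 (\<lambda>t. norm (x t) powr p)"
proof -
  \<comment> \<open>The midpoint of 2^(1-p) and 1. The mean of two halves contributes 2^-p and the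
    doubled weight 2, leaving room for (1 + e)^p up to \<rho> 2^(p-1), which exceeds 1.\<close>
  define \<rho> where "\<rho> = (1 + 2 powr (1 - p)) / 2"
  have p0: "0 < p" using p by simp
  have "2 powr (1 - p) < 2 powr (0::real)" using p by (intro powr_less_mono) auto
  then have rho: "2 powr (1 - p) < \<rho>" "\<rho> < 1" "0 < \<rho>" by (auto simp: \<rho>_def field_simps add_pos_pos)
  have "2 powr (p - 1) * 2 powr (1 - p) = (1::real)" by (simp flip: powr_add)
  then have M: "1 < \<rho> * 2 powr (p - 1)"
    using mult_strict_left_mono[OF rho(1), of "2 powr (p - 1)"] by (simp add: mult.commute)
  obtain e where e: "0 < e" "(1 + e) powr p = \<rho> * 2 powr (p - 1)"
    using exists_powr_eq[OF M p0] by blast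
  define K where "K = (1 + 1/e) powr p"
  have K0: "0 \<le> K" by (simp add: K_def)
  define B where "B = (1 + K) / (1 - \<rho>)"
  have B0: "0 \<le> B" using K0 rho by (simp add: B_def)
  define C where "C = 2 powr p * (3 * B + 2)"
  have C0: "0 \<le> C" using B0 by (simp add: C_def)
  have main: "(\<Sum>n\<in>Nset_below d (2 ^ L). norm (coef x n) powr p * wt n) \<le> C * integral\<^sup>L I01 (\<lambda>t. norm (x t) powr p)"
    if x: "Lp p x" for d x L
  proof -
    let ?F = "Nset_below d (2 ^ L)"
    have xi: "integrable I01 x" using Lp_imp_integrable[OF _ x] p by simp
    define I where "I = integral\<^sup>L I01 (\<lambda>t. norm (x t) powr p)"
    have I0: "0 \<le> I" unfolding I_def by simp
    define W where "W n = norm (avg x n) powr p * wt n" for n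
    have W0: "0 \<le> W n" for n using wt_pos[of n] by (simp add: W_def)
    have Wle: "W n \<le> dyad_energy p x n" if "0 < n" for n
      using avg_powr_le[OF p x that] by (simp add: W_def)
    have step: "W n \<le> \<rho> * W (2 * n) + K * W (Suc (2 * n))" if n: "0 < n" for n
    proof -
      have "avg x n = (avg x (2 * n) + avg x (Suc (2 * n))) / 2"
        using avg_double[OF n xi] by simp
      then have "norm (avg x n) powr p = norm (avg x (2 * n) + avg x (Suc (2 * n))) powr p / 2 powr p"
        by (simp only:) (simp add: norm_divide powr_divide)
      also have "\<dots> \<le> ((1 + e) powr p * norm (avg x (2 * n)) powr p + K * norm (avg x (Suc (2 * n))) powr p) / 2 powr p"
        using norm_add_powr_le_weighted[OF e(1) p0] by (intro divide_right_mono) (auto simp: K_def)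
      finally have "W n \<le> ((1 + e) powr p * norm (avg x (2 * n)) powr p + K * norm (avg x (Suc (2 * n))) powr p) / 2 powr p * wt n"
        unfolding W_def by (rule mult_right_mono) (simp add: wt_pos less_imp_le)
      also have "\<dots> = (2 * (1 + e) powr p / 2 powr p) * W (2 * n) + (2 / 2 powr p) * (K * W (Suc (2 * n)))"
        unfolding W_def wt_double[OF n] wt_Suc_double[OF n] by (simp add: field_simps)
      also have "2 * (1 + e) powr p / 2 powr p = \<rho>"
        by (simp add: e powr_diff)
      also have "(2 / 2 powr p) * (K * W (Suc (2 * n))) \<le> 1 * (K * W (Suc (2 * n)))"
        using p K0 W0 powr_mono[of 1 p 2] by (intro mult_right_mono) auto
      finally show ?thesis by simp
    qed
    have right: "(\<Sum>n\<in>?F. W (Suc (2 * n))) \<le> I"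
    proof -
      have "(\<Sum>n\<in>?F. W (Suc (2 * n))) = (\<Sum>n\<in>(\<lambda>n. Suc (2 * n)) ` ?F. W n)"
        by (simp add: sum.reindex inj_on_def)
      also have "\<dots> \<le> (\<Sum>n\<in>(\<lambda>n. Suc (2 * n)) ` ?F. dyad_energy p x n)"
        by (intro sum_mono Wle) auto
      also have "\<dots> \<le> I" unfolding I_def
      proof (rule sum_dyad_energy_le[OF x])
        fix t m n
        assume *: "m \<in> (\<lambda>n. Suc (2 * n)) ` ?F" "n \<in> (\<lambda>n. Suc (2 * n)) ` ?F" "t \<in> dyad m" "t \<in> dyad n"
        have N: "odd k \<and> k \<in> N_set (Suc d)" if "k \<in> (\<lambda>n. Suc (2 * n)) ` ?F" for k
          using that by (auto simp: Nset_below_def N_set_iff ones_Suc_double)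
        show "m = n" using N[OF *(1)] N[OF *(2)] *(3,4) by (auto intro: odd_dyad_unique)
      qed auto
      finally show ?thesis .
    qed
    \<comment> \<open>Truncating at a power of 2 ensures that doubled nodes leaving the range all
      have level L. Their intervals are disjoint, so together they cost at most I.\<close>
    have left: "(\<Sum>n\<in>?F. W (2 * n)) \<le> (\<Sum>n\<in>?F. W n) + I"
    proof -
      let ?G = "{n \<in> (\<lambda>n. 2 * n) ` ?F. \<not> n < 2 ^ L}"
      have lev: "lev n = L" if "n \<in> ?G" for n
        using that by (intro lev_eqI) (auto simp: Nset_below_def)
      have "(\<Sum>n\<in>?F. W (2 * n)) = (\<Sum>n\<in>(\<lambda>n. 2 * n) ` ?F. W n)"
        by (simp add: sum.reindex inj_on_def)
      also have "\<dots> \<le> (\<Sum>n\<in>?F \<union> ?G. W n)"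
        using W0 by (intro sum_mono2) (auto simp: Nset_below_def N_set_iff ones_double)
      also have "\<dots> \<le> (\<Sum>n\<in>?F. W n) + (\<Sum>n\<in>?G. W n)"
        by (subst sum.union_disjoint) (auto simp: Nset_below_def)
      also have "(\<Sum>n\<in>?G. W n) \<le> (\<Sum>n\<in>?G. dyad_energy p x n)"
        by (intro sum_mono Wle) (auto dest: Nset_below_pos)
      also have "\<dots> \<le> I" unfolding I_def
      proof (rule sum_dyad_energy_le[OF x])
        have pos: "0 < n" if "n \<in> ?G" for n using that by (auto dest: Nset_below_pos)
        show "m = n" if "m \<in> ?G" "n \<in> ?G" "t \<in> dyad m" "t \<in> dyad n" for t m n
          using tpath_unique[OF pos[OF that(1)] that(3)] tpath_unique[OF pos[OF that(2)] that(4)]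
            lev[OF that(1)] lev[OF that(2)] by simp
      qed (auto dest: Nset_below_pos)
      finally show ?thesis by simp
    qed
    have "(\<Sum>n\<in>?F. W n) \<le> (\<Sum>n\<in>?F. \<rho> * W (2 * n) + K * W (Suc (2 * n)))"
      by (intro sum_mono step) (rule Nset_below_pos)
    also have "\<dots> = \<rho> * (\<Sum>n\<in>?F. W (2 * n)) + K * (\<Sum>n\<in>?F. W (Suc (2 * n)))"
      by (simp add: sum.distrib sum_distrib_left)
    also have "\<dots> \<le> \<rho> * ((\<Sum>n\<in>?F. W n) + I) + K * I"
      using left right rho K0 by (intro add_mono mult_left_mono) auto
    finally have "(1 - \<rho>) * (\<Sum>n\<in>?F. W n) \<le> (\<rho> + K) * I" by (simp add: algebra_simps)
    also have "\<dots> \<le> (1 + K) * I" using rho I0 by (intro mult_right_mono) auto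
    finally have WB: "(\<Sum>n\<in>?F. W n) \<le> B * I"
      using rho by (simp add: B_def field_simps)
    have "(\<Sum>n\<in>?F. norm (coef x n) powr p * wt n) \<le> (\<Sum>n\<in>?F. 2 powr p * (2 * W (2 * n) + W n))"
    proof (rule sum_mono)
      fix n assume "n \<in> ?F"
      then have n: "0 < n" by (rule Nset_below_pos)
      have "coef x n = avg x (2 * n) - avg x n" using avg_double(1)[OF n xi] by simp
      then have "norm (coef x n) powr p * wt n
          \<le> 2 powr p * (norm (avg x (2 * n)) powr p + norm (avg x n) powr p) * wt n"
        using norm_diff_powr_le[OF p0] wt_pos[of n] by (intro mult_right_mono) auto
      then show "norm (coef x n) powr p * wt n \<le> 2 powr p * (2 * W (2 * n) + W n)"
        unfolding W_def wt_double[OF n] by (simp add: algebra_simps)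
    qed
    also have "\<dots> = 2 powr p * (2 * (\<Sum>n\<in>?F. W (2 * n)) + (\<Sum>n\<in>?F. W n))"
      by (simp add: sum.distrib flip: sum_distrib_left)
    also have "\<dots> \<le> 2 powr p * (2 * (B * I + I) + B * I)"
      using left WB by (intro mult_left_mono add_mono) auto
    finally show ?thesis by (simp add: C_def I_def algebra_simps)
  qed
  have "(\<Sum>n\<in>Nset_below d N. norm (coef x n) powr p * wt n) \<le> C * integral\<^sup>L I01 (\<lambda>t. norm (x t) powr p)"
    if x: "Lp p x" for d x N
  proof -
    have "(\<Sum>n\<in>Nset_below d N. norm (coef x n) powr p * wt n) \<le> (\<Sum>n\<in>Nset_below d (2 ^ N). norm (coef x n) powr p * wt n)"
      using wt_pos less_trans[OF _ less_exp[of N]]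
      by (intro sum_mono2) (auto simp: Nset_below_def less_imp_le)
    then show ?thesis using main[OF x, of d N] by simp
  qed
  then show thesis using that C0 by blast
qed

subsection \<open>Convergence of the stopped averages\<close>

text \<open>The stopped average is a conditional expectation onto the disjoint intervals of the odd
  nodes of \<open>N_set (Suc D)\<close>; Jensen's inequality on each of them gives the
  contraction.\<close>

lemma avg_stop_contraction:
  assumes p: "1 < p" and x: "Lp p x" and m: "(\<lambda>t. avg x (stop (Suc D) t)) \<in> borel_measurable I01"
  shows "Lp p (\<lambda>t. avg x (stop (Suc D) t))"
    and "integral\<^sup>L I01 (\<lambda>t. norm (avg x (stop (Suc D) t)) powr p) \<le> integral\<^sup>L I01 (\<lambda>t. norm (x t) powr p)"
proof -
  define I where "I = integral\<^sup>L I01 (\<lambda>t. norm (x t) powr p)"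
  have I0: "0 \<le> I" unfolding I_def by simp
  define Q where "Q = {q \<in> N_set (Suc D). odd q}"
  define g where "g n t = ennreal (if n \<in> Q then norm (avg x n) powr p else 0) * indicator (dyad n) t" for n t
  have gm: "g n \<in> borel_measurable I01" for n
  proof (cases "n \<in> Q")
    case True
    then have "dyad n \<in> sets I01" by (intro sets_dyad) (auto simp: Q_def odd_pos)
    then show ?thesis unfolding g_def by measurable
  qed (simp add: g_def[abs_def])
  have "(\<integral>\<^sup>+t. ennreal (norm (avg x (stop (Suc D) t)) powr p) \<partial>I01) \<le> (\<integral>\<^sup>+t. (\<Sum>n. g n t) \<partial>I01)"
  proof (rule nn_integral_mono)
    fix t assume "t \<in> space I01"
    then have t: "t \<in> {0<..1}" by simp
    note st = stop_props[OF t, of "Suc D"]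
    have "ennreal (norm (avg x (stop (Suc D) t)) powr p) = g (stop (Suc D) t) t"
      using st by (simp add: g_def Q_def)
    also have "\<dots> \<le> (\<Sum>n. g n t)"
      using sum_le_suminf[OF summableI, of "{stop (Suc D) t}" "\<lambda>n. g n t"] by simp
    finally show "ennreal (norm (avg x (stop (Suc D) t)) powr p) \<le> (\<Sum>n. g n t)" .
  qed
  also have "\<dots> = (\<Sum>n. \<integral>\<^sup>+t. g n t \<partial>I01)"
    by (intro nn_integral_suminf gm)
  also have "\<dots> \<le> (\<Sum>n. ennreal (if n \<in> Q then dyad_energy p x n else 0))"
  proof (intro suminf_le summableI)
    fix n
    show "(\<integral>\<^sup>+t. g n t \<partial>I01) \<le> ennreal (if n \<in> Q then dyad_energy p x n else 0)"
    proof (cases "n \<in> Q")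
      case True
      then have n: "0 < n" by (simp add: Q_def odd_pos)
      have "(\<integral>\<^sup>+t. g n t \<partial>I01) = ennreal (norm (avg x n) powr p) * ennreal (wt n)"
        unfolding g_def using n True by (subst nn_integral_cmult_indicator) (auto simp: emeasure_dyad sets_dyad)
      also have "\<dots> = ennreal (norm (avg x n) powr p * wt n)"
        using wt_pos[of n] by (intro ennreal_mult[symmetric]) auto
      finally show ?thesis using avg_powr_le[OF p x n] True by (simp add: ennreal_leI)
    qed (simp add: g_def)
  qed
  also have "\<dots> \<le> ennreal I"
  proof (rule suminf_le_const)
    fix N
    have e0: "0 \<le> dyad_energy p x n" if "0 < n" for n
      using order_trans[OF _ avg_powr_le[OF p x that]] wt_pos[of n] by simp
    have "(\<Sum>n<N. ennreal (if n \<in> Q then dyad_energy p x n else 0))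
        = ennreal (\<Sum>n<N. if n \<in> Q then dyad_energy p x n else 0)"
      using e0 by (intro sum_ennreal) (auto simp: Q_def odd_pos)
    also have "(\<Sum>n<N. if n \<in> Q then dyad_energy p x n else 0) = (\<Sum>n\<in>Q \<inter> {..<N}. dyad_energy p x n)"
      by (rule sum.mono_neutral_cong_right) auto
    also have "\<dots> \<le> I" unfolding I_def
      by (rule sum_dyad_energy_le[OF x]) (auto simp: Q_def intro: odd_dyad_unique)
    finally show "(\<Sum>n<N. ennreal (if n \<in> Q then dyad_energy p x n else 0)) \<le> ennreal I"
      by (simp add: ennreal_leI)
  qed simp
  finally have "(\<integral>\<^sup>+t. ennreal (norm (avg x (stop (Suc D) t)) powr p) \<partial>I01) \<le> ennreal I" .
  from Lp_of_nn_integral[OF m I0 this]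
  show "Lp p (\<lambda>t. avg x (stop (Suc D) t))"
    and "integral\<^sup>L I01 (\<lambda>t. norm (avg x (stop (Suc D) t)) powr p) \<le> integral\<^sup>L I01 (\<lambda>t. norm (x t) powr p)"
    unfolding I_def by blast+
qed

section \<open>Density of continuous functions in L^p\<close>

lemma Lp_diff:
  assumes p: "0 < p" and u: "Lp p u" and v: "Lp p v"
  shows "Lp p (\<lambda>t. u t - v t)"
    and "integral\<^sup>L I01 (\<lambda>t. norm (u t - v t) powr p)
      \<le> 2 powr p * (integral\<^sup>L I01 (\<lambda>t. norm (u t) powr p) + integral\<^sup>L I01 (\<lambda>t. norm (v t) powr p))"
proof -
  have m: "u \<in> borel_measurable I01" "v \<in> borel_measurable I01" using u v by (auto simp: Lp_def)
  have i: "integrable I01 (\<lambda>t. norm (u t) powr p)" "integrable I01 (\<lambda>t. norm (v t) powr p)"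
    using u v by (auto simp: Lp_def)
  then have i2: "integrable I01 (\<lambda>t. 2 powr p * (norm (u t) powr p + norm (v t) powr p))" by simp
  have md: "(\<lambda>t. u t - v t) \<in> borel_measurable I01" using m by measurable
  have "integrable I01 (\<lambda>t. norm (u t - v t) powr p)"
  proof (rule Bochner_Integration.integrable_bound[OF i2])
    show "(\<lambda>t. norm (u t - v t) powr p) \<in> borel_measurable I01" using md by measurable
    show "AE t in I01. norm (norm (u t - v t) powr p) \<le> norm (2 powr p * (norm (u t) powr p + norm (v t) powr p))"
      by (intro always_eventually allI) (simp add: norm_diff_powr_le[OF p])
  qed
  then show "Lp p (\<lambda>t. u t - v t)" using md by (simp add: Lp_def)
  have "integral\<^sup>L I01 (\<lambda>t. norm (u t - v t) powr p)
      \<le> integral\<^sup>L I01 (\<lambda>t. 2 powr p * (norm (u t) powr p + norm (v t) powr p))"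
    using \<open>integrable I01 (\<lambda>t. norm (u t - v t) powr p)\<close> i2 norm_diff_powr_le[OF p]
    by (intro integral_mono)
  also have "\<dots> = 2 powr p * (integral\<^sup>L I01 (\<lambda>t. norm (u t) powr p) + integral\<^sup>L I01 (\<lambda>t. norm (v t) powr p))"
    using i by simp
  finally show "integral\<^sup>L I01 (\<lambda>t. norm (u t - v t) powr p)
      \<le> 2 powr p * (integral\<^sup>L I01 (\<lambda>t. norm (u t) powr p) + integral\<^sup>L I01 (\<lambda>t. norm (v t) powr p))" .
qed

lemma measure_I01: "measure I01 {0<..1} = 1"
  by (simp add: measure_restrict_space)

lemma Lp_bounded:
  assumes p: "0 < p" and m: "u \<in> borel_measurable I01" and b: "\<And>t. t \<in> {0<..1} \<Longrightarrow> norm (u t) \<le> K"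
  shows "Lp p u" "integral\<^sup>L I01 (\<lambda>t. norm (u t) powr p) \<le> K powr p"
proof -
  have le: "norm (u t) powr p \<le> K powr p" if "t \<in> space I01" for t
    using b[of t] that p by (intro powr_mono2) auto
  have i: "integrable I01 (\<lambda>t. norm (u t) powr p)"
  proof (rule Bochner_Integration.integrable_bound[of _ "\<lambda>t. K powr p"])
    show "(\<lambda>t. norm (u t) powr p) \<in> borel_measurable I01" using m by measurable
    show "AE t in I01. norm (norm (u t) powr p) \<le> norm (K powr p)" using le by (intro AE_I2) simp
  qed simp
  then show "Lp p u" using m by (simp add: Lp_def)
  have "integral\<^sup>L I01 (\<lambda>t. norm (u t) powr p) \<le> integral\<^sup>L I01 (\<lambda>t. K powr p)"
    using i le by (intro integral_mono) auto
  then show "integral\<^sup>L I01 (\<lambda>t. norm (u t) powr p) \<le> K powr p" by (simp add: measure_I01)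
qed

lemma continuous_borel_measurable_I01:
  fixes g :: "real \<Rightarrow> complex"
  assumes "continuous_on UNIV g"
  shows "g \<in> borel_measurable I01"
  by (rule continuous_imp_measurable_on_sets_lebesgue)
    (use assms in \<open>auto intro: continuous_on_subset\<close>)

text \<open>Measurability gives continuous functions converging to x almost everywhere, but without
  a dominating function. Clipping values to a large disc supplies one, at the cost of a first small
  error between x and its clipped version.\<close>

lemma Lp_approx_continuous:
  assumes p: "0 < p" and x: "Lp p x" and \<epsilon>: "0 < \<epsilon>"
  obtains g where "continuous_on UNIV g" "Lp p g" "Lp p (\<lambda>t. x t - g t)"
    "integral\<^sup>L I01 (\<lambda>t. norm (x t - g t) powr p) < \<epsilon>"
proof -
  \<comment> \<open>The metric projection onto the disc is continuous, so clipping a continuous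
    function leaves it continuous.\<close>
  define T where "T M = closest_point (cball (0::complex) M)" for M
  have T_cont: "continuous_on UNIV (T M)" if "0 \<le> M" for M
    unfolding T_def using that by (intro continuous_on_closest_point) auto
  have T_le: "norm (T M z) \<le> M" if "0 \<le> M" for M z
    using closest_point_in_set[of "cball (0::complex) M" z] that by (simp add: T_def)
  have T_near: "norm (z - T M z) \<le> norm z" if "0 \<le> M" for M z
    using closest_point_le[of "cball (0::complex) M" 0 z] that by (simp add: T_def dist_norm)
  have T_id: "T M z = z" if "norm z \<le> M" for M z
    using that by (simp add: T_def closest_point_self)
  have xm: "x \<in> borel_measurable I01" and xi: "integrable I01 (\<lambda>t. norm (x t) powr p)"
    using x by (auto simp: Lp_def)
  have Tm: "(\<lambda>t. T M (u t)) \<in> borel_measurable I01" if "u \<in> borel_measurable I01" "0 \<le> M" for u M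
    using measurable_compose[OF that(1) borel_measurable_continuous_onI[OF T_cont[OF that(2)]]] .
  define \<eta> where "\<eta> = \<epsilon> / (2 powr p * 2)"
  have \<eta>0: "0 < \<eta>" using \<epsilon> by (simp add: \<eta>_def)
  have "(\<lambda>M. integral\<^sup>L I01 (\<lambda>t. norm (x t - T (real M) (x t)) powr p)) \<longlonglongrightarrow> integral\<^sup>L I01 (\<lambda>t. 0)"
  proof (rule integral_dominated_convergence[OF _ _ xi])
    show "AE t in I01. (\<lambda>M. norm (x t - T (real M) (x t)) powr p) \<longlonglongrightarrow> 0"
    proof (rule always_eventually, rule allI)
      fix t
      obtain M :: nat where M: "norm (x t) \<le> real M" using real_arch_simple by blast
      have "norm (x t - T (real m) (x t)) powr p = 0" if "M \<le> m" for m
        using M that p by (subst T_id) auto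
      then show "(\<lambda>M. norm (x t - T (real M) (x t)) powr p) \<longlonglongrightarrow> 0"
        by (intro tendsto_eventually) (auto simp: eventually_sequentially)
    qed
    show "AE t in I01. norm (norm (x t - T (real M) (x t)) powr p) \<le> norm (x t) powr p" for M
      using T_near p by (intro always_eventually allI) (simp add: powr_mono2)
    show "(\<lambda>t. norm (x t - T (real M) (x t)) powr p) \<in> borel_measurable I01" for M
      using xm Tm[OF xm, of "real M"] by measurable
  qed simp
  then have "(\<lambda>M. integral\<^sup>L I01 (\<lambda>t. norm (x t - T (real M) (x t)) powr p)) \<longlonglongrightarrow> 0" by simp
  then obtain M :: nat where M: "integral\<^sup>L I01 (\<lambda>t. norm (x t - T (real M) (x t)) powr p) < \<eta>"
    using order_tendstoD(2)[OF _ \<eta>0] by (metis (no_types, lifting) eventually_sequentially order_refl)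
  define S where "S = T (real M)"
  have S_cont: "continuous_on UNIV S" unfolding S_def by (rule T_cont) simp
  have S_le: "norm (S z) \<le> real M" for z unfolding S_def by (rule T_le) simp
  have Sm: "(\<lambda>t. S (u t)) \<in> borel_measurable I01" if "u \<in> borel_measurable I01" for u
    unfolding S_def using that by (rule Tm) simp
  have "x measurable_on {0<..1}"
    using xm by (subst measurable_on_iff_borel_measurable) auto
  then obtain N g where N: "negligible N" and g: "\<And>n. continuous_on UNIV (g n)"
    and lim: "\<And>t. t \<notin> N \<Longrightarrow> (\<lambda>n. g n t) \<longlonglongrightarrow> (if t \<in> {0<..1} then x t else 0)"
    unfolding measurable_on_def by blast
  have gm: "g n \<in> borel_measurable I01" for n using g by (rule continuous_borel_measurable_I01)
  have "(\<lambda>n. integral\<^sup>L I01 (\<lambda>t. norm (S (x t) - S (g n t)) powr p)) \<longlonglongrightarrow> integral\<^sup>L I01 (\<lambda>t. 0)"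
  proof (rule integral_dominated_convergence[where w = "\<lambda>t. (2 * real M) powr p"])
    have "AE t in lebesgue. t \<notin> N"
      using N by (intro AE_not_in) (simp add: negligible_iff_null_sets)
    then have "AE t in I01. t \<notin> N"
      by (subst AE_restrict_space_iff) auto
    then show "AE t in I01. (\<lambda>n. norm (S (x t) - S (g n t)) powr p) \<longlonglongrightarrow> 0"
      using AE_space
    proof eventually_elim
      case (elim t)
      then have "(\<lambda>n. g n t) \<longlonglongrightarrow> x t" using lim[of t] by simp
      then have "(\<lambda>n. S (g n t)) \<longlonglongrightarrow> S (x t)"
        using S_cont by (metis continuous_on_eq_continuous_at open_UNIV UNIV_I isCont_tendsto_compose)
      then have "(\<lambda>n. S (x t) - S (g n t)) \<longlonglongrightarrow> S (x t) - S (x t)" by (intro tendsto_intros)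
      then have "(\<lambda>n. norm (S (x t) - S (g n t))) \<longlonglongrightarrow> 0" by (simp add: tendsto_norm_zero)
      then show ?case by (rule tendsto_zero_powrI[OF _ tendsto_const]) (use p in auto)
    qed
    show "AE t in I01. norm (norm (S (x t) - S (g n t)) powr p) \<le> (2 * real M) powr p" for n
    proof (intro always_eventually allI)
      fix t
      have "norm (S (x t) - S (g n t)) \<le> 2 * real M"
        using norm_triangle_ineq4[of "S (x t)" "S (g n t)"] S_le[of "x t"] S_le[of "g n t"] by simp
      then show "norm (norm (S (x t) - S (g n t)) powr p) \<le> (2 * real M) powr p"
        using p by (simp add: powr_mono2)
    qed
    show "(\<lambda>t. norm (S (x t) - S (g n t)) powr p) \<in> borel_measurable I01" for n
      using Sm[OF xm] Sm[OF gm[of n]] by measurable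
  qed simp_all
  then have "(\<lambda>n. integral\<^sup>L I01 (\<lambda>t. norm (S (x t) - S (g n t)) powr p)) \<longlonglongrightarrow> 0" by simp
  then obtain n where n: "integral\<^sup>L I01 (\<lambda>t. norm (S (x t) - S (g n t)) powr p) < \<eta>"
    using order_tendstoD(2)[OF _ \<eta>0] by (metis (no_types, lifting) eventually_sequentially order_refl)
  define h where "h t = S (g n t)" for t
  have h_cont: "continuous_on UNIV h"
    unfolding h_def using g[of n] S_cont by (metis continuous_on_compose2 subset_UNIV)
  have h_Lp: "Lp p h"
    using Lp_bounded(1)[OF p Sm[OF gm[of n]], of "real M"] S_le by (simp add: h_def[abs_def])
  have Sx: "Lp p (\<lambda>t. S (x t))" using Lp_bounded(1)[OF p Sm[OF xm]] S_le by blast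
  have "integral\<^sup>L I01 (\<lambda>t. norm (x t - h t) powr p)
      = integral\<^sup>L I01 (\<lambda>t. norm ((x t - S (x t)) - (h t - S (x t))) powr p)" by simp
  also have "\<dots> \<le> 2 powr p * (integral\<^sup>L I01 (\<lambda>t. norm (x t - S (x t)) powr p)
      + integral\<^sup>L I01 (\<lambda>t. norm (h t - S (x t)) powr p))"
    by (intro Lp_diff(2) Lp_diff(1) p x Sx h_Lp)
  also have "integral\<^sup>L I01 (\<lambda>t. norm (h t - S (x t)) powr p) = integral\<^sup>L I01 (\<lambda>t. norm (S (x t) - S (g n t)) powr p)"
    by (simp add: h_def norm_minus_commute)
  also have "2 powr p * (integral\<^sup>L I01 (\<lambda>t. norm (x t - S (x t)) powr p)
      + integral\<^sup>L I01 (\<lambda>t. norm (S (x t) - S (g n t)) powr p)) < 2 powr p * (\<eta> + \<eta>)"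
    using M n by (intro mult_strict_left_mono add_strict_mono) (auto simp: S_def)
  also have "\<dots> = \<epsilon>" by (simp add: \<eta>_def)
  finally show thesis using that h_cont h_Lp Lp_diff(1)[OF p x h_Lp] by blast
qed

section \<open>Uniform approximation of continuous functions by stopped averages\<close>

lemma avg_diff:
  assumes "0 < n" "integrable I01 x" "integrable I01 y"
  shows "avg (\<lambda>t. x t - y t) n = avg x n - avg y n"
  unfolding avg_def using assms
  by (simp add: set_integral_diff set_integrable_dyad right_diff_distrib)

lemma norm_avg_diff_const_le:
  assumes n: "0 < n" and x: "integrable I01 x" and b: "\<And>s. s \<in> dyad n \<Longrightarrow> norm (x s - z) \<le> \<epsilon>"
  shows "norm (avg x n - z) \<le> \<epsilon>"
proof -
  have emeas: "emeasure I01 (dyad n) \<noteq> \<infinity>" "measure I01 (dyad n) = wt n"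
    using emeasure_dyad[OF n] wt_pos[of n] by (auto simp: measure_def less_imp_le)
  have "avg (\<lambda>s. z) n = z"
    using emeas n by (simp add: avg_def set_integral_const sets_dyad wt_def scaleR_conv_of_real power_one_over)
  then have "norm (avg x n - z) * wt n = norm (avg (\<lambda>s. x s - z) n) * wt n"
    using avg_diff[OF n x, of "\<lambda>_. z"] by simp
  also have "\<dots> \<le> (LINT s:dyad n|I01. norm (x s - z))"
    using x by (intro norm_avg_le n) simp
  also have "\<dots> \<le> (LINT s:dyad n|I01. \<epsilon>)"
  proof (rule set_integral_mono)
    show "set_integrable I01 (dyad n) (\<lambda>s. norm (x s - z))"
      using x by (intro set_integrable_dyad n integrable_norm) simp
    show "set_integrable I01 (dyad n) (\<lambda>s. \<epsilon>)" by (intro set_integrable_dyad n) simp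
  qed (rule b)
  also have "\<dots> = \<epsilon> * wt n" by (rule set_integral_dyad_const[OF n])
  finally show ?thesis using wt_pos[of n] by simp
qed

lemma dist_dyad_le: "s \<in> dyad n \<Longrightarrow> t \<in> dyad n \<Longrightarrow> dist s t \<le> wt n"
  by (auto simp: dyad_def wt_def dist_real_def power_one_over add_divide_distrib)

text \<open>A node of level l has at most l + 1 binary ones. So the stopping intervals for
  \<open>Suc D\<close> have length at most 2^-D, uniformly in t.\<close>

lemma lev_stop_ge:
  assumes "t \<in> {0<..1}"
  shows "D \<le> lev (stop (Suc D) t)"
proof -
  have "ones (tpath t l) \<le> Suc l" for l
    by (induction l) (auto simp: ones_double ones_Suc_double)
  moreover have "stop (Suc D) t = tpath t (lev (stop (Suc D) t))"
    using stop_props[OF assms, of "Suc D"] by (intro tpath_unique) (auto simp: odd_pos)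
  moreover have "ones (stop (Suc D) t) = Suc D"
    using stop_props[OF assms, of "Suc D"] by (simp add: N_set_iff)
  ultimately show ?thesis by (metis Suc_le_mono)
qed

lemma avg_stop_uniform:
  assumes g: "continuous_on UNIV g" "integrable I01 g" and \<epsilon>: "0 < \<epsilon>"
  obtains D0 where "\<And>D t. D0 \<le> D \<Longrightarrow> t \<in> {0<..1} \<Longrightarrow> norm (avg g (stop (Suc D) t) - g t) \<le> \<epsilon>"
proof -
  have "uniformly_continuous_on {0..1} g"
    using g(1) by (intro compact_uniformly_continuous) (auto intro: continuous_on_subset)
  then obtain \<delta> where \<delta>: "0 < \<delta>"
    "\<And>s t. s \<in> {0..1} \<Longrightarrow> t \<in> {0..1} \<Longrightarrow> dist s t < \<delta> \<Longrightarrow> dist (g s) (g t) < \<epsilon>"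
    using \<epsilon> unfolding uniformly_continuous_on_def by metis
  obtain D0 where D0: "(1/2::real) ^ D0 < \<delta>" using real_arch_pow_inv[OF \<delta>(1), of "1/2"] by auto
  have "norm (avg g (stop (Suc D) t) - g t) \<le> \<epsilon>" if D: "D0 \<le> D" and t: "t \<in> {0<..1}" for D t
  proof -
    define q where "q = stop (Suc D) t"
    have q: "0 < q" "t \<in> dyad q" using stop_props[OF t, of "Suc D"] by (auto simp: q_def odd_pos)
    have "wt q \<le> (1/2) ^ D0"
      unfolding wt_def q_def using lev_stop_ge[OF t, of D] D by (intro power_decreasing) auto
    then have w: "wt q < \<delta>" using D0 by simp
    have "norm (g s - g t) \<le> \<epsilon>" if "s \<in> dyad q" for s
    proof -
      have "s \<in> {0..1}" using that dyad_subset[OF q(1)] by auto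
      moreover have "dist s t < \<delta>" using dist_dyad_le[OF that q(2)] w by simp
      ultimately have "dist (g s) (g t) < \<epsilon>" using \<delta>(2)[of s t] t by simp
      then show ?thesis by (simp add: dist_norm)
    qed
    then show ?thesis unfolding q_def[symmetric] by (intro norm_avg_diff_const_le q(1) g(2))
  qed
  then show thesis using that by blast
qed

lemma sum_haar_sum_coef:
  assumes "t \<in> {0<..1}" "integrable I01 x"
  shows "(\<Sum>d = 1..D. haar_sum d (coef x) t) = avg x (stop (Suc D) t) - integral\<^sup>L I01 x"
  using sum_haar_sum_telescope[OF assms(1), of "avg x" "coef x" D] avg_double[OF _ assms(2)]
  by (simp add: avg_one[simplified])

text \<open>Read off from the telescoping identity, whose other side is a finite sum of measurable
  Haar sums and a constant.\<close>

lemma avg_stop_measurable: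
  assumes "integrable I01 x"
  shows "(\<lambda>t. avg x (stop (Suc D) t)) \<in> borel_measurable I01"
proof -
  have "(\<lambda>t. (\<Sum>d = 1..D. haar_sum d (coef x) t) + integral\<^sup>L I01 x) \<in> borel_measurable I01"
    by (intro borel_measurable_add borel_measurable_sum borel_measurable_haar_sum) auto
  then show ?thesis
    by (rule measurable_cong[THEN iffD1, rotated]) (use sum_haar_sum_coef[OF _ assms] in auto)
qed

lemma avg_stop_Lp_conv:
  assumes p: "1 < p" and x: "Lp p x"
  shows "Lp_conv p (\<lambda>D t. avg x (stop (Suc D) t)) x"
  unfolding Lp_conv_def
proof (rule LIMSEQ_I)
  fix r :: real assume r: "0 < r"
  have p0: "0 < p" "1 \<le> p" using p by auto
  \<comment> \<open>Splitting the error into three parts applies the power inequality twice and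
    yields 2^p (\<eta> + 2^p (\<eta> + \<eta>)), which this choice makes r/2.\<close>
  define \<eta> where "\<eta> = r / (2 powr p * (1 + 2 powr p * 2) * 2)"
  have "0 < 2 powr p * (1 + 2 powr p * (2::real)) * 2" by (simp add: add_pos_pos)
  then have \<eta>0: "0 < \<eta>" using r by (simp only: \<eta>_def zero_less_divide_iff) simp
  have \<eta>r: "2 powr p * (\<eta> + 2 powr p * (\<eta> + \<eta>)) < r"
  proof -
    have "2 powr p * (\<eta> + 2 powr p * (\<eta> + \<eta>)) = r / 2"
    proof -
      have "2 powr p * (\<eta> + 2 powr p * (\<eta> + \<eta>)) = \<eta> * (2 powr p * (1 + 2 powr p * 2))"
        by (simp add: algebra_simps)
      moreover have "2 powr p * (1 + 2 powr p * (2::real)) \<noteq> 0"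
        by (simp add: add_pos_pos less_imp_neq[symmetric])
      ultimately show ?thesis by (simp only: \<eta>_def) simp
    qed
    then show ?thesis using r by simp
  qed
  obtain g where g: "continuous_on UNIV g" "Lp p g" "Lp p (\<lambda>t. x t - g t)"
    "integral\<^sup>L I01 (\<lambda>t. norm (x t - g t) powr p) < \<eta>"
    using Lp_approx_continuous[OF p0(1) x \<eta>0] .
  have xi: "integrable I01 x" and gi: "integrable I01 g" and xgi: "integrable I01 (\<lambda>t. x t - g t)"
    using Lp_imp_integrable[OF p0(2)] x g by auto
  have "0 < \<eta> powr (1/p)" using \<eta>0 by simp
  then obtain D0 where D0: "\<And>D t. D0 \<le> D \<Longrightarrow> t \<in> {0<..1} \<Longrightarrow> norm (avg g (stop (Suc D) t) - g t) \<le> \<eta> powr (1/p)"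
    using avg_stop_uniform[OF g(1) gi] by metis
  have "integral\<^sup>L I01 (\<lambda>t. norm (avg x (stop (Suc D) t) - x t) powr p) < r" if D: "D0 \<le> D" for D
  proof -
    define u where "u t = avg (\<lambda>s. x s - g s) (stop (Suc D) t)" for t
    define v where "v t = avg g (stop (Suc D) t) - g t" for t
    have u: "Lp p u" "integral\<^sup>L I01 (\<lambda>t. norm (u t) powr p) \<le> \<eta>"
      using avg_stop_contraction[OF p g(3) avg_stop_measurable[OF xgi], of D] g(4)
      by (auto simp: u_def[abs_def])
    have vm: "v \<in> borel_measurable I01"
      unfolding v_def[abs_def] using avg_stop_measurable[OF gi, of D] continuous_borel_measurable_I01[OF g(1)]
      by (rule borel_measurable_diff)
    have v: "Lp p v" "integral\<^sup>L I01 (\<lambda>t. norm (v t) powr p) \<le> \<eta>"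
      using Lp_bounded[OF p0(1) vm, of "\<eta> powr (1/p)"] D0[OF D] \<eta>0 p
      by (auto simp: v_def powr_powr)
    have "integral\<^sup>L I01 (\<lambda>t. norm (avg x (stop (Suc D) t) - x t) powr p)
        = integral\<^sup>L I01 (\<lambda>t. norm (u t - ((x t - g t) - v t)) powr p)"
    proof (rule Bochner_Integration.integral_cong)
      fix t assume "t \<in> space I01"
      then have "0 < stop (Suc D) t" using stop_props(1)[of t "Suc D"] by (simp add: odd_pos)
      then have "u t = avg x (stop (Suc D) t) - avg g (stop (Suc D) t)"
        using avg_diff[OF _ xi gi] by (simp add: u_def)
      then show "norm (avg x (stop (Suc D) t) - x t) powr p = norm (u t - ((x t - g t) - v t)) powr p"
        by (simp add: v_def)
    qed simp
    also have "\<dots> \<le> 2 powr p * (integral\<^sup>L I01 (\<lambda>t. norm (u t) powr p)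
        + integral\<^sup>L I01 (\<lambda>t. norm ((x t - g t) - v t) powr p))"
      by (intro Lp_diff p0 u v g)
    also have "\<dots> \<le> 2 powr p * (\<eta> + 2 powr p * (\<eta> + \<eta>))"
    proof (intro mult_left_mono add_mono u)
      have "integral\<^sup>L I01 (\<lambda>t. norm ((x t - g t) - v t) powr p)
        \<le> 2 powr p * (integral\<^sup>L I01 (\<lambda>t. norm (x t - g t) powr p) + integral\<^sup>L I01 (\<lambda>t. norm (v t) powr p))"
        by (intro Lp_diff p0 v g)
      also have "\<dots> \<le> 2 powr p * (\<eta> + \<eta>)"
        using v(2) g(4) by (intro mult_left_mono add_mono) auto
      finally show "integral\<^sup>L I01 (\<lambda>t. norm ((x t - g t) - v t) powr p) \<le> 2 powr p * (\<eta> + \<eta>)" .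
    qed auto
    finally show ?thesis using \<eta>r by simp
  qed
  then show "\<exists>D0. \<forall>D\<ge>D0. norm (integral\<^sup>L I01 (\<lambda>t. norm (avg x (stop (Suc D) t) - x t) powr p) - 0) < r"
    by (intro exI[of _ D0]) auto
qed

subsection \<open>The expansion\<close>

text \<open>\<open>N_set d\<close> is a union of complete chains, so setting a to 0 outside it does
  not change the convolution inside, and the bound over all nodes restricts.\<close>

lemma chain_conv_bounded_Nset:
  assumes "u \<in> Mp p (2 powr (-1/p))" "0 < p"
  obtains C where "0 \<le> C" "\<And>a d N. (\<Sum>n\<in>Nset_below d N. norm (chain_conv (taylor u) a n) powr p * wt n)
    \<le> C * (\<Sum>n\<in>Nset_below d N. norm (a n) powr p * wt n)"
proof -
  obtain C where C: "0 \<le> C" "\<And>a N. (\<Sum>n\<in>{0<..<N}. norm (chain_conv (taylor u) a n) powr p * wt n)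
    \<le> C * (\<Sum>n\<in>{0<..<N}. norm (a n) powr p * wt n)"
    using chain_conv_bounded[OF assms] by blast
  have "(\<Sum>n\<in>Nset_below d N. norm (chain_conv (taylor u) a n) powr p * wt n)
    \<le> C * (\<Sum>n\<in>Nset_below d N. norm (a n) powr p * wt n)" for a d N
  proof -
    define a' where "a' n = (if n \<in> N_set d then a n else 0)" for n
    have "chain_conv (taylor u) a n = chain_conv (taylor u) a' n" if n: "n \<in> N_set d" for n
    proof -
      have n0: "0 < n" using n by (simp add: N_set_iff)
      obtain i q where q: "odd q" "n = 2 ^ i * q" using pow_mult_odd_cases[OF n0] .
      have "2 ^ k * q \<in> N_set d" for k
        using n q by (simp add: N_set_iff ones_pow_mult odd_pos)
      then show ?thesis unfolding q(2) chain_conv_pow_mult[OF q(1)] by (simp add: a'_def)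
    qed
    then have "(\<Sum>n\<in>Nset_below d N. norm (chain_conv (taylor u) a n) powr p * wt n)
        = (\<Sum>n\<in>Nset_below d N. norm (chain_conv (taylor u) a' n) powr p * wt n)"
      by (intro sum.cong) (auto simp: Nset_below_def)
    also have "\<dots> \<le> (\<Sum>n\<in>{0<..<N}. norm (chain_conv (taylor u) a' n) powr p * wt n)"
      using wt_pos by (intro sum_mono2) (auto simp: Nset_below_def N_set_iff less_imp_le)
    also have "\<dots> \<le> C * (\<Sum>n\<in>{0<..<N}. norm (a' n) powr p * wt n)" by (rule C)
    also have "(\<Sum>n\<in>{0<..<N}. norm (a' n) powr p * wt n) = (\<Sum>n\<in>Nset_below d N. norm (a n) powr p * wt n)"
      by (rule sum.mono_neutral_cong_right) (auto simp: Nset_below_def N_set_iff a'_def)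
    finally show ?thesis .
  qed
  then show thesis using that C(1) by blast
qed

lemma chaos_partial_sums_Lp_conv:
  assumes p: "1 < p" and M1: "symbol c \<in> Mp p (2 powr (-1/p))" and tc: "taylor (symbol c) = c"
    and inv: "Abs_fps c * Abs_fps \<delta> = 1" and d: "1 \<le> d" and xi: "integrable I01 x"
    and bd: "\<And>N. (\<Sum>n\<in>Nset_below d N. norm (chain_conv \<delta> (coef x) n) powr p * wt n) \<le> K"
  shows "Lp_conv p (\<lambda>N t. \<Sum>n \<in> {n \<in> N_set d. n < N}. pair x (gfun \<delta> n) * dil (haar_chaos c) n t)
    (haar_sum d (coef x))"
proof -
  have p0: "0 < p" using p by simp
  define y where "y = chain_conv \<delta> (coef x)"
  define T where "T n = (if n \<in> N_set d then norm (y n) powr p * wt n else 0)" for n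
  have T0: "0 \<le> T n" for n using wt_pos[of n] by (simp add: T_def)
  have TN: "(\<Sum>n<N. T n) = (\<Sum>n\<in>Nset_below d N. norm (y n) powr p * wt n)" for N
    by (rule sum.mono_neutral_cong_right) (auto simp: T_def Nset_below_def)
  have sT: "summable T"
    using bd[folded y_def] TN T0 by (intro summableI_nonneg_bounded) auto
  define r where "r N = suminf T - (\<Sum>n<N. T n)" for N
  have "(\<lambda>N. suminf T - (\<Sum>n<N. T n)) \<longlonglongrightarrow> suminf T - suminf T"
    by (intro tendsto_intros summable_LIMSEQ sT)
  then have r: "r \<longlonglongrightarrow> 0" by (simp add: r_def[abs_def])
  obtain B where B: "0 \<le> B" "\<And>a d N. (\<Sum>n\<in>Nset_below d N. norm (chain_conv c a n) powr p * wt n)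
      \<le> B * (\<Sum>n\<in>Nset_below d N. norm (a n) powr p * wt n)"
    using chain_conv_bounded_Nset[OF M1 p0] unfolding tc by blast
  obtain A where A: "0 \<le> A" "\<And>d a K. 1 \<le> d \<Longrightarrow>
    (\<And>N. (\<Sum>n\<in>Nset_below d N. norm (a n) powr p * wt n) \<le> K) \<Longrightarrow>
    Lp p (haar_sum d a) \<and> integral\<^sup>L I01 (\<lambda>t. norm (haar_sum d a t) powr p) \<le> A * K"
    using haar_sum_bounded[OF p0] by blast
  have bound: "integral\<^sup>L I01 (\<lambda>t. norm ((\<Sum>n \<in> {n \<in> N_set d. n < N}.
      pair x (gfun \<delta> n) * dil (haar_chaos c) n t) - haar_sum d (coef x) t) powr p) \<le> A * (B * r N)" for N
  proof -
    \<comment> \<open>Zero below N and -y from N on; the weighted p-mass of a in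
      \<open>N_set d\<close> is thus at most the tail \<open>r N\<close>.\<close>
    define a where "a n = (if n < N then y n else 0) - y n" for n
    have "(\<Sum>n\<in>Nset_below d M. norm (a n) powr p * wt n) \<le> r N" for M
    proof -
      have "(\<Sum>n\<in>Nset_below d M. norm (a n) powr p * wt n) + (\<Sum>n<N. T n)
          \<le> (\<Sum>n\<in>{N..<M}. T n) + (\<Sum>n<N. T n)"
      proof (intro add_right_mono)
        have "(\<Sum>n\<in>Nset_below d M. norm (a n) powr p * wt n) = (\<Sum>n\<in>{N..<M}. T n)"
          using p0 by (intro sum.mono_neutral_cong) (auto simp: a_def T_def Nset_below_def)
        then show "(\<Sum>n\<in>Nset_below d M. norm (a n) powr p * wt n) \<le> (\<Sum>n\<in>{N..<M}. T n)" by simp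
      qed
      also have "\<dots> = (\<Sum>n\<in>{N..<M} \<union> {..<N}. T n)" by (subst sum.union_disjoint) auto
      also have "\<dots> \<le> suminf T" using T0 by (intro sum_le_suminf sT) auto
      finally show ?thesis by (simp add: r_def)
    qed
    then have "(\<Sum>n\<in>Nset_below d M. norm (chain_conv c a n) powr p * wt n) \<le> B * r N" for M
      using order_trans[OF B(2) mult_left_mono[OF _ B(1)]] by blast
    then have "integral\<^sup>L I01 (\<lambda>t. norm (haar_sum d (chain_conv c a) t) powr p) \<le> A * (B * r N)"
      using A(2)[OF d] by blast
    also have "integral\<^sup>L I01 (\<lambda>t. norm (haar_sum d (chain_conv c a) t) powr p)
      = integral\<^sup>L I01 (\<lambda>t. norm ((\<Sum>n \<in> {n \<in> N_set d. n < N}.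
          pair x (gfun \<delta> n) * dil (haar_chaos c) n t) - haar_sum d (coef x) t) powr p)"
    proof (rule Bochner_Integration.integral_cong)
      fix t assume "t \<in> space I01"
      then have t: "t \<in> {0<..1}" by simp
      obtain q k where "path_data d q k t" using path_data_exists[OF t d] .
      then interpret path_data d q k t .
      have "(\<Sum>n \<in> {n \<in> N_set d. n < N}. pair x (gfun \<delta> n) * dil (haar_chaos c) n t)
          = (\<Sum>n \<in> {n \<in> N_set d. n < N}. y n * dil (haar_chaos c) n t)"
        by (intro sum.cong) (auto simp: y_def N_set_iff pair_gfun[OF _ xi])
      also have "\<dots> = haar_sum d (chain_conv c (\<lambda>n. if n < N then y n else 0)) t"
        by (rule partial_sum_eq)
      also have "haar_sum d (coef x) t = haar_sum d (chain_conv c y) t"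
        unfolding haar_sum_def y_def
        by (intro sum.cong) (auto simp: N_set_iff chain_conv_inverse[OF inv])
      ultimately have "(\<Sum>n \<in> {n \<in> N_set d. n < N}. pair x (gfun \<delta> n) * dil (haar_chaos c) n t) - haar_sum d (coef x) t
          = haar_sum d (chain_conv c a) t"
        by (simp add: a_def[abs_def] chain_conv_diff[abs_def] haar_sum_diff)
      then show "norm (haar_sum d (chain_conv c a) t) powr p = norm ((\<Sum>n \<in> {n \<in> N_set d. n < N}.
          pair x (gfun \<delta> n) * dil (haar_chaos c) n t) - haar_sum d (coef x) t) powr p" by simp
    qed simp
    finally show ?thesis .
  qed
  have "(\<lambda>N. A * (B * r N)) \<longlonglongrightarrow> A * (B * 0)" by (intro tendsto_intros r)
  then have lim: "(\<lambda>N. A * (B * r N)) \<longlonglongrightarrow> 0" by simp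
  show ?thesis unfolding Lp_conv_def
    by (rule tendsto_sandwich[OF _ _ tendsto_const lim]) (use bound in auto)
qed

theorem theorem4:
  fixes p :: real and c :: "nat \<Rightarrow> complex"
  assumes p: "1 < p"
    and fLp: "Lp p (haar_chaos c)"
    and conv: "\<forall>z \<in> ball 0 (2 powr (-1/p)). summable (\<lambda>k. c k * z ^ k)"
    and M1: "symbol c \<in> Mp p (2 powr (-1/p))"
    and nz: "\<forall>z \<in> ball 0 (2 powr (-1/p)). symbol c z \<noteq> 0"
    and M2: "(\<lambda>z. inverse (symbol c z)) \<in> Mp p (2 powr (-1/p))"
  shows "\<forall>x. Lp p x \<and> integral\<^sup>L I01 x = 0 \<longrightarrow>
           (\<exists>xd :: nat \<Rightarrow> real \<Rightarrow> complex.
              (\<forall>d \<ge> 1. Lp p (xd d) \<and>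
                 Lp_conv p (\<lambda>N t. \<Sum>n \<in> {n \<in> N_set d. n < N}.
                      pair x (gfun (taylor (\<lambda>z. inverse (symbol c z))) n) * dil (haar_chaos c) n t)
                   (xd d)) \<and>
              Lp_conv p (\<lambda>D t. \<Sum>d = 1..D. xd d t) x)"
proof (intro allI impI)
  fix x assume "Lp p x \<and> integral\<^sup>L I01 x = 0"
  then have x: "Lp p x" and x0: "integral\<^sup>L I01 x = 0" by auto
  have p0: "0 < p" using p by simp
  have xi: "integrable I01 x" using Lp_imp_integrable[OF _ x] p by simp
  have R: "0 < (2::real) powr (-1/p)" by simp
  define \<delta> where "\<delta> = taylor (\<lambda>z. inverse (symbol c z))"
  have tc: "taylor (symbol c) = c" using taylor_symbol[OF R conv] .
  have inv: "Abs_fps c * Abs_fps \<delta> = 1" unfolding \<delta>_def by (rule symbol_mult_inverse[OF R conv nz])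
  obtain H where H: "0 \<le> H" "\<And>d x N. Lp p x \<Longrightarrow>
    (\<Sum>n\<in>Nset_below d N. norm (coef x n) powr p * wt n) \<le> H * integral\<^sup>L I01 (\<lambda>t. norm (x t) powr p)"
    using sum_coef_powr_bounded[OF p] by blast
  obtain B where B: "0 \<le> B" "\<And>a d N. (\<Sum>n\<in>Nset_below d N. norm (chain_conv \<delta> a n) powr p * wt n)
      \<le> B * (\<Sum>n\<in>Nset_below d N. norm (a n) powr p * wt n)"
    using chain_conv_bounded_Nset[OF M2 p0] unfolding \<delta>_def by blast
  obtain A where A: "\<And>d a K. 1 \<le> d \<Longrightarrow>
    (\<And>N. (\<Sum>n\<in>Nset_below d N. norm (a n) powr p * wt n) \<le> K) \<Longrightarrow>
    Lp p (haar_sum d a) \<and> integral\<^sup>L I01 (\<lambda>t. norm (haar_sum d a t) powr p) \<le> A * K"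
    using haar_sum_bounded[OF p0] by blast
  have "Lp p (haar_sum d (coef x)) \<and> Lp_conv p (\<lambda>N t. \<Sum>n \<in> {n \<in> N_set d. n < N}.
      pair x (gfun \<delta> n) * dil (haar_chaos c) n t) (haar_sum d (coef x))" if d: "1 \<le> d" for d
  proof
    show "Lp p (haar_sum d (coef x))" using A[OF d H(2)[OF x]] by blast
    show "Lp_conv p (\<lambda>N t. \<Sum>n \<in> {n \<in> N_set d. n < N}.
      pair x (gfun \<delta> n) * dil (haar_chaos c) n t) (haar_sum d (coef x))"
      by (rule chaos_partial_sums_Lp_conv[OF p M1 tc inv d xi])
        (rule order_trans[OF B(2) mult_left_mono[OF H(2)[OF x] B(1)]])
  qed
  moreover have "Lp_conv p (\<lambda>D t. \<Sum>d = 1..D. haar_sum d (coef x) t) x"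
  proof -
    \<comment> \<open>The telescoped sum is the stopped average minus the average at the root, and
      the latter vanishes because x has mean zero.\<close>
    have "integral\<^sup>L I01 (\<lambda>t. norm ((\<Sum>d = 1..D. haar_sum d (coef x) t) - x t) powr p)
        = integral\<^sup>L I01 (\<lambda>t. norm (avg x (stop (Suc D) t) - x t) powr p)" for D
      by (rule Bochner_Integration.integral_cong) (auto simp: sum_haar_sum_coef[OF _ xi, simplified] x0)
    then show ?thesis using avg_stop_Lp_conv[OF p x] by (simp add: Lp_conv_def)
  qed
  ultimately show "\<exists>xd :: nat \<Rightarrow> real \<Rightarrow> complex.
              (\<forall>d \<ge> 1. Lp p (xd d) \<and>
                 Lp_conv p (\<lambda>N t. \<Sum>n \<in> {n \<in> N_set d. n < N}.
                      pair x (gfun (taylor (\<lambda>z. inverse (symbol c z))) n) * dil (haar_chaos c) n t)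
                   (xd d)) \<and>
              Lp_conv p (\<lambda>D t. \<Sum>d = 1..D. xd d t) x"
    unfolding \<delta>_def[symmetric] by (intro exI[of _ "\<lambda>d. haar_sum d (coef x)"]) blast
qed

end
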